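(* Let $p\ge 2$, let $b_1,\ldots,b_p$ be real numbers with $b_1\le b_2\le\cdots\le b_p$, and let $(a_k)_{k\ge 0}$ be real numbers with $\sum_k|a_k|<\infty$. Let $A$ be the bounded operator on $l^2(\mathbb{Z})$ defined by the doubly infinite block Toeplitz-Laurent matrix $(A_{i-j})_{i,j\in\mathbb{Z}}$ with $p\times p$ blocks, where $$A_0=\begin{bmatrix} b_1&1&&&&a_0\\ 1&b_2&1&&&\\ &1&\cdot&\cdot&&\\ &&\cdot&\cdot&\cdot&\\ &&&\cdot&\cdot&1\\ a_0&&&&1&b_p\end{bmatrix},\qquad A_k=\begin{bmatrix}&&a_k\\&&\\&&\end{bmatrix}=A_{-k}^T\quad(k\ge 1).$$ If $A$ has connected essential spectrum, then $b_1=b_2=\cdots=b_p$.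
   Context: Entries not displayed are zero. Precisely, $A_0$ is the symmetric tridiagonal $p\times p$ matrix with diagonal $b_1,\ldots,b_p$ and all sub- and super-diagonal entries equal to $1$, plus $a_0$ added in positions $(1,p)$ and $(p,1)$; for $k\ge1$, $A_k$ has $a_k$ in position $(1,p)$ and zeros elsewhere, and $A_{-k}=A_k^T$. (So when $p=2$ the off-diagonal entries of $A_0$ are $1+a_0$.) The block matrix acts on $l^2(\mathbb{Z})$ identified with $l^2(\mathbb{Z},\mathbb{C}^p)$. *)

theory Defs
  imports "HOL-Analysis.Analysis" "HOL-Library.Function_Algebras"
begin

interpretation cfun: vector_space "\<lambda>(c::complex) (f::int \<Rightarrow> complex) i. c * f i"
  by unfold_locales (auto simp: fun_eq_iff algebra_simps)

definition l2 :: "(int \<Rightarrow> complex) set" where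
  "l2 = {f. (\<lambda>i. (cmod (f i))\<^sup>2) summable_on UNIV}"

definition l2_norm :: "(int \<Rightarrow> complex) \<Rightarrow> real" where
  "l2_norm f = sqrt (\<Sum>\<^sub>\<infinity>i. (cmod (f i))\<^sup>2)"

definition l2_dist :: "(int \<Rightarrow> complex) \<Rightarrow> (int \<Rightarrow> complex) \<Rightarrow> real" where
  "l2_dist f g = l2_norm (f - g)"

lemma l2_finite_bound:
  assumes "f \<in> l2" "finite F"
  shows "L2_set (\<lambda>i. cmod (f i)) F \<le> l2_norm f"
  using assms unfolding L2_set_def l2_norm_def l2_def
  by (auto intro!: finite_sum_le_infsum)

lemma l2_boundI:
  assumes "\<And>F. finite F \<Longrightarrow> L2_set (\<lambda>i. cmod (f i)) F \<le> C"
  shows "f \<in> l2" "l2_norm f \<le> C"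
proof -
  have C: "C \<ge> 0" using assms[of "{}"] by simp
  have le: "(\<Sum>i\<in>F. (cmod (f i))\<^sup>2) \<le> C\<^sup>2" if "finite F" for F
  proof -
    have "sqrt (\<Sum>i\<in>F. (cmod (f i))\<^sup>2) \<le> C"
      using assms[OF that] by (simp add: L2_set_def)
    then show ?thesis
      using real_le_rsqrt sqrt_le_D by blast
  qed
  have s: "(\<lambda>i. (cmod (f i))\<^sup>2) summable_on UNIV"
    by (rule nonneg_bdd_above_summable_on)
       (use le in \<open>auto intro!: bdd_aboveI[of _ "C\<^sup>2"]\<close>)
  then show "f \<in> l2" by (simp add: l2_def)
  have "(\<Sum>\<^sub>\<infinity>i. (cmod (f i))\<^sup>2) \<le> C\<^sup>2"
    by (rule infsum_le_finite_sums[OF s]) (use le in auto)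
  then show "l2_norm f \<le> C"
    using C unfolding l2_norm_def by (simp add: real_le_lsqrt infsum_nonneg)
qed

lemma l2_add:
  assumes "f \<in> l2" "g \<in> l2"
  shows "f + g \<in> l2" "l2_norm (f + g) \<le> l2_norm f + l2_norm g"
proof -
  have "L2_set (\<lambda>i. cmod ((f + g) i)) F \<le> l2_norm f + l2_norm g" if "finite F" for F
  proof -
    have "L2_set (\<lambda>i. cmod ((f + g) i)) F \<le> L2_set (\<lambda>i. cmod (f i) + cmod (g i)) F"
      by (rule L2_set_mono) (auto intro: norm_triangle_ineq)
    also have "\<dots> \<le> L2_set (\<lambda>i. cmod (f i)) F + L2_set (\<lambda>i. cmod (g i)) F"
      by (rule L2_set_triangle_ineq)
    also have "\<dots> \<le> l2_norm f + l2_norm g"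
      by (intro add_mono l2_finite_bound assms that)
    finally show ?thesis .
  qed
  from l2_boundI[OF this] show "f + g \<in> l2" "l2_norm (f + g) \<le> l2_norm f + l2_norm g"
    by blast+
qed

lemma l2_uminus: "- f \<in> l2 \<longleftrightarrow> f \<in> l2" "l2_norm (- f) = l2_norm f"
  by (simp_all add: l2_def l2_norm_def)

lemma l2_diff: "f \<in> l2 \<Longrightarrow> g \<in> l2 \<Longrightarrow> f - g \<in> l2"
  using l2_add(1)[of f "- g"] by (simp add: l2_uminus)

lemma l2_norm_eq_0:
  assumes "f \<in> l2" "l2_norm f = 0"
  shows "f = 0"
proof
  fix i
  show "f i = 0 i"
    using l2_finite_bound[OF assms(1), of "{i}"] assms(2) by simp
qed

interpretation l2: Metric_space l2 l2_dist
proof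
  fix f g h
  show "0 \<le> l2_dist f g"
    by (simp add: l2_dist_def l2_norm_def infsum_nonneg)
  show "l2_dist f g = l2_dist g f"
    using l2_uminus(2)[of "f - g"] by (simp add: l2_dist_def)
  assume f: "f \<in> l2" and g: "g \<in> l2"
  show "l2_dist f g = 0 \<longleftrightarrow> f = g"
    using l2_norm_eq_0[OF l2_diff[OF f g]] by (auto simp: l2_dist_def l2_norm_def)
  assume h: "h \<in> l2"
  show "l2_dist f h \<le> l2_dist f g + l2_dist g h"
    using l2_add(2)[OF l2_diff[OF f g] l2_diff[OF g h]] by (simp add: l2_dist_def)
qed

text \<open>An operator on \<^term>\<open>l2\<close> is a function on all sequences of which only the restriction to
  \<^term>\<open>l2\<close> matters. Both notions below presuppose that this restriction is a bounded linear
  operator from \<^term>\<open>l2\<close> to itself.\<close>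

definition fredholm :: "((int \<Rightarrow> complex) \<Rightarrow> (int \<Rightarrow> complex)) \<Rightarrow> bool" where
  "fredholm T \<longleftrightarrow>
     (\<exists>B. finite B \<and> {f \<in> l2. T f = 0} \<subseteq> cfun.span B) \<and>
     closedin l2.mtopology (T ` l2) \<and>
     (\<exists>B. finite B \<and> B \<subseteq> l2 \<and> (\<forall>g\<in>l2. \<exists>f\<in>l2. g - T f \<in> cfun.span B))"

definition essential_spectrum :: "((int \<Rightarrow> complex) \<Rightarrow> (int \<Rightarrow> complex)) \<Rightarrow> complex set" where
  "essential_spectrum T = {z. \<not> fredholm (\<lambda>f i. T f i - z * f i)}"

text \<open>Entry \<open>(i, j)\<close>, with \<open>1 \<le> i, j \<le> p\<close>, of the block \<open>A\<^sub>k\<close>. The summands in the case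
  \<open>k = 0\<close> overlap for \<open>p = 2\<close>, where the off-diagonal entries are \<open>1 + a\<^sub>0\<close>.\<close>

definition block :: "nat \<Rightarrow> (nat \<Rightarrow> real) \<Rightarrow> (nat \<Rightarrow> real) \<Rightarrow> int \<Rightarrow> nat \<Rightarrow> nat \<Rightarrow> real" where
  "block p b a k i j =
     (if k = 0 then
        (if i = j then b i else 0) + (if i = j + 1 \<or> j = i + 1 then 1 else 0) +
        (if (i = 1 \<and> j = p) \<or> (i = p \<and> j = 1) then a 0 else 0)
      else if k > 0 then (if i = 1 \<and> j = p then a (nat k) else 0)
      else (if j = 1 \<and> i = p then a (nat (- k)) else 0))"

text \<open>Entry \<open>(m, n)\<close> of the doubly infinite matrix: the index \<open>m = p * q + r\<close> with \<open>0 \<le> r < p\<close>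
  stands for position \<open>r + 1\<close> in block \<open>q\<close>.\<close>

definition laurent_entry :: "nat \<Rightarrow> (nat \<Rightarrow> real) \<Rightarrow> (nat \<Rightarrow> real) \<Rightarrow> int \<Rightarrow> int \<Rightarrow> real" where
  "laurent_entry p b a m n =
     block p b a (m div int p - n div int p) (nat (m mod int p) + 1) (nat (n mod int p) + 1)"

text \<open>For absolutely summable \<open>a\<close> the series below converges absolutely for every \<open>f\<close> in
  \<^term>\<open>l2\<close> and defines a bounded operator; see \<open>laurent_operator_bounded\<close>.\<close>

definition laurent_operator ::
    "nat \<Rightarrow> (nat \<Rightarrow> real) \<Rightarrow> (nat \<Rightarrow> real) \<Rightarrow> (int \<Rightarrow> complex) \<Rightarrow> (int \<Rightarrow> complex)" where
  "laurent_operator p b a f m = (\<Sum>\<^sub>\<infinity>n. of_real (laurent_entry p b a m n) * f n)"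

lemma l2_schur_test:
  fixes M :: "int \<Rightarrow> int \<Rightarrow> real"
  assumes row: "\<And>m F. finite F \<Longrightarrow> (\<Sum>n\<in>F. \<bar>M m n\<bar>) \<le> C"
    and col: "\<And>n F. finite F \<Longrightarrow> (\<Sum>m\<in>F. \<bar>M m n\<bar>) \<le> C"
    and f: "f \<in> l2"
  shows "(\<lambda>n. cmod (of_real (M m n) * f n)) summable_on UNIV"
    and "(\<lambda>m. \<Sum>\<^sub>\<infinity>n. of_real (M m n) * f n) \<in> l2"
    and "l2_norm (\<lambda>m. \<Sum>\<^sub>\<infinity>n. of_real (M m n) * f n) \<le> C * l2_norm f"
proof -
  have C: "C \<ge> 0" using row[of "{}"] by simp
  have nf: "l2_norm f \<ge> 0" by (simp add: l2_norm_def infsum_nonneg)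
  have fle: "cmod (f n) \<le> l2_norm f" for n
    using l2_finite_bound[OF f, of "{n}"] by simp
  show summ: "(\<lambda>n. cmod (of_real (M m n) * f n)) summable_on UNIV" for m
  proof (rule nonneg_bdd_above_summable_on)
    show "bdd_above (sum (\<lambda>n. norm (of_real (M m n) * f n)) ` {F. F \<subseteq> UNIV \<and> finite F})"
    proof (rule bdd_aboveI2)
      fix F :: "int set" assume "F \<in> {F. F \<subseteq> UNIV \<and> finite F}"
      then have F: "finite F" by simp
      have "(\<Sum>n\<in>F. norm (of_real (M m n) * f n)) \<le> (\<Sum>n\<in>F. \<bar>M m n\<bar> * l2_norm f)"
        by (intro sum_mono) (simp add: norm_mult mult_left_mono fle)
      also have "\<dots> = (\<Sum>n\<in>F. \<bar>M m n\<bar>) * l2_norm f" by (simp add: sum_distrib_right)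
      also have "\<dots> \<le> C * l2_norm f" by (intro mult_right_mono row F nf)
      finally show "(\<Sum>n\<in>F. norm (of_real (M m n) * f n)) \<le> C * l2_norm f" .
    qed
  qed simp
  have fin: "(\<Sum>m\<in>F. (cmod (\<Sum>n\<in>G. of_real (M m n) * f n))\<^sup>2) \<le> (C * l2_norm f)\<^sup>2"
    if F: "finite F" and G: "finite G" for F G
  proof -
    have "(cmod (\<Sum>n\<in>G. of_real (M m n) * f n))\<^sup>2 \<le> C * (\<Sum>n\<in>G. \<bar>M m n\<bar> * (cmod (f n))\<^sup>2)" for m
    proof -
      have "cmod (\<Sum>n\<in>G. of_real (M m n) * f n) \<le> (\<Sum>n\<in>G. \<bar>M m n\<bar> * cmod (f n))"
        by (rule order_trans[OF norm_sum]) (simp add: norm_mult)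
      also have "\<dots> = (\<Sum>n\<in>G. sqrt \<bar>M m n\<bar> * (sqrt \<bar>M m n\<bar> * cmod (f n)))"
        by (simp flip: mult.assoc)
      finally have "(cmod (\<Sum>n\<in>G. of_real (M m n) * f n))\<^sup>2 \<le>
          (\<Sum>n\<in>G. sqrt \<bar>M m n\<bar> * (sqrt \<bar>M m n\<bar> * cmod (f n)))\<^sup>2"
        by (intro power_mono) auto
      also have "\<dots> \<le> (\<Sum>n\<in>G. (sqrt \<bar>M m n\<bar>)\<^sup>2) * (\<Sum>n\<in>G. (sqrt \<bar>M m n\<bar> * cmod (f n))\<^sup>2)"
        by (rule Cauchy_Schwarz_ineq_sum)
      also have "\<dots> = (\<Sum>n\<in>G. \<bar>M m n\<bar>) * (\<Sum>n\<in>G. \<bar>M m n\<bar> * (cmod (f n))\<^sup>2)"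
        by (simp add: power_mult_distrib)
      also have "\<dots> \<le> C * (\<Sum>n\<in>G. \<bar>M m n\<bar> * (cmod (f n))\<^sup>2)"
        by (intro mult_right_mono row G sum_nonneg) auto
      finally show ?thesis .
    qed
    then have "(\<Sum>m\<in>F. (cmod (\<Sum>n\<in>G. of_real (M m n) * f n))\<^sup>2) \<le>
        (\<Sum>m\<in>F. C * (\<Sum>n\<in>G. \<bar>M m n\<bar> * (cmod (f n))\<^sup>2))"
      by (rule sum_mono)
    also have "\<dots> = C * (\<Sum>m\<in>F. \<Sum>n\<in>G. \<bar>M m n\<bar> * (cmod (f n))\<^sup>2)"
      by (simp add: sum_distrib_left)
    also have "(\<Sum>m\<in>F. \<Sum>n\<in>G. \<bar>M m n\<bar> * (cmod (f n))\<^sup>2) =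
        (\<Sum>n\<in>G. (\<Sum>m\<in>F. \<bar>M m n\<bar>) * (cmod (f n))\<^sup>2)"
      by (subst sum.swap) (simp add: sum_distrib_right)
    also have "C * \<dots> \<le> C * (\<Sum>n\<in>G. C * (cmod (f n))\<^sup>2)"
      by (intro mult_left_mono sum_mono mult_right_mono col F C) auto
    also have "\<dots> = C\<^sup>2 * (L2_set (\<lambda>n. cmod (f n)) G)\<^sup>2"
      by (simp add: L2_set_def sum_nonneg power2_eq_square flip: sum_distrib_left)
    also have "\<dots> \<le> C\<^sup>2 * (l2_norm f)\<^sup>2"
      by (intro mult_left_mono power_mono l2_finite_bound f G) auto
    finally show ?thesis by (simp add: power_mult_distrib)
  qed
  have "L2_set (\<lambda>m. cmod (\<Sum>\<^sub>\<infinity>n. of_real (M m n) * f n)) F \<le> C * l2_norm f"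
    if F: "finite F" for F
  proof -
    have "((\<lambda>G. \<Sum>m\<in>F. (cmod (\<Sum>n\<in>G. of_real (M m n) * f n))\<^sup>2) \<longlongrightarrow>
        (\<Sum>m\<in>F. (cmod (\<Sum>\<^sub>\<infinity>n. of_real (M m n) * f n))\<^sup>2)) (finite_subsets_at_top UNIV)"
      by (intro tendsto_sum tendsto_power tendsto_norm infsum_tendsto abs_summable_summable[OF summ])
    then have "(\<Sum>m\<in>F. (cmod (\<Sum>\<^sub>\<infinity>n. of_real (M m n) * f n))\<^sup>2) \<le> (C * l2_norm f)\<^sup>2"
      by (rule tendsto_upperbound) (auto intro!: eventually_finite_subsets_at_top_weakI fin F)
    then show ?thesis
      unfolding L2_set_def using C nf by (intro real_le_lsqrt) (auto intro: sum_nonneg)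
  qed
  from l2_boundI[OF this]
  show "(\<lambda>m. \<Sum>\<^sub>\<infinity>n. of_real (M m n) * f n) \<in> l2"
    and "l2_norm (\<lambda>m. \<Sum>\<^sub>\<infinity>n. of_real (M m n) * f n) \<le> C * l2_norm f"
    by blast+
qed

lemma block_sym: "block p b a (- k) j i = block p b a k i j"
  by (auto simp: block_def)

lemma laurent_entry_sym: "laurent_entry p b a n m = laurent_entry p b a m n"
  unfolding laurent_entry_def by (subst block_sym[symmetric]) simp

lemma laurent_entry_row_sum:
  assumes p: "p \<ge> 2" and a: "summable (\<lambda>k. \<bar>a k\<bar>)"
  obtains C where "\<And>m F. finite F \<Longrightarrow> (\<Sum>n\<in>F. \<bar>laurent_entry p b a m n\<bar>) \<le> C"
proof -
  define \<beta> where "\<beta> = (\<Sum>i\<in>{1..p}. \<bar>b i\<bar>) + 1"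
  have b: "\<bar>b i\<bar> + 1 \<le> \<beta>" if "i \<in> {1..p}" for i
    unfolding \<beta>_def using member_le_sum[OF that, of "\<lambda>i. \<bar>b i\<bar>"] by simp
  have \<beta>: "\<beta> \<ge> 0" by (simp add: \<beta>_def sum_nonneg add_nonneg_nonneg)
  have bl: "\<bar>block p b a k i j\<bar> \<le> (if k = 0 then \<beta> else 0) + \<bar>a (nat \<bar>k\<bar>)\<bar>"
    if "i \<in> {1..p}" for k i j
  proof (cases "k = 0")
    case True
    have "\<bar>if i = j then b i else 0\<bar> + \<bar>if i = j + 1 \<or> j = i + 1 then 1 else 0\<bar> \<le> \<beta>"
      using b[OF that] by (cases "i = j") auto
    moreover have "\<bar>if (i = 1 \<and> j = p) \<or> (i = p \<and> j = 1) then a 0 else 0\<bar> \<le> \<bar>a 0\<bar>"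
      by simp
    moreover have "\<bar>x + y + z\<bar> \<le> \<beta> + c" if "\<bar>x\<bar> + \<bar>y\<bar> \<le> \<beta>" "\<bar>z\<bar> \<le> c" for x y z c :: real
      using that by linarith
    ultimately show ?thesis
      unfolding block_def by (simp only: True simp_thms if_True abs_zero nat_0)
  next
    case False
    then show ?thesis by (cases "k > 0") (simp_all add: block_def)
  qed
  have suma: "(\<Sum>k\<in>K. \<bar>a (nat \<bar>k\<bar>)\<bar>) \<le> 2 * (\<Sum>k. \<bar>a k\<bar>)" if K: "finite K" for K
  proof -
    have inj: "inj_on (\<lambda>k. nat \<bar>k\<bar>) (K \<inter> {0..})" "inj_on (\<lambda>k. nat \<bar>k\<bar>) (K - {0..})"
      by (auto simp: inj_on_def)
    have "(\<Sum>k\<in>K. \<bar>a (nat \<bar>k\<bar>)\<bar>) =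
        (\<Sum>k\<in>K \<inter> {0..}. \<bar>a (nat \<bar>k\<bar>)\<bar>) + (\<Sum>k\<in>K - {0..}. \<bar>a (nat \<bar>k\<bar>)\<bar>)"
      by (rule sum.Int_Diff[OF K])
    also have "\<dots> = (\<Sum>k\<in>(\<lambda>k. nat \<bar>k\<bar>) ` (K \<inter> {0..}). \<bar>a k\<bar>) +
        (\<Sum>k\<in>(\<lambda>k. nat \<bar>k\<bar>) ` (K - {0..}). \<bar>a k\<bar>)"
      by (simp only: sum.reindex[OF inj(1)] sum.reindex[OF inj(2)] o_def)
    also have "\<dots> \<le> (\<Sum>k. \<bar>a k\<bar>) + (\<Sum>k. \<bar>a k\<bar>)"
      by (intro add_mono sum_le_suminf a) (auto simp: K)
    finally show ?thesis by simp
  qed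
  have "(\<Sum>n\<in>F. \<bar>laurent_entry p b a m n\<bar>) \<le> real p * (\<beta> + 2 * (\<Sum>k. \<bar>a k\<bar>))"
    if F: "finite F" for m F
  proof -
    define i where "i = nat (m mod int p) + 1"
    have m: "0 \<le> m mod int p" "m mod int p < int p" using p by simp_all
    have i: "i \<in> {1..p}" using m unfolding i_def by auto
    define g where "g n = (m div int p - n div int p, nat (n mod int p))" for n
    define K where "K = (\<lambda>n. m div int p - n div int p) ` F"
    have K: "finite K" using F by (simp add: K_def)
    have inj: "inj_on g F"
    proof (rule inj_onI)
      fix x y assume "g x = g y"
      then have "x div int p = y div int p" "nat (x mod int p) = nat (y mod int p)"
        by (simp_all add: g_def)
      moreover have "x mod int p \<ge> 0" "y mod int p \<ge> 0" using p by simp_all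
      ultimately have "x div int p = y div int p" "x mod int p = y mod int p" by linarith+
      then show "x = y" by (metis div_mult_mod_eq)
    qed
    have sub: "g ` F \<subseteq> K \<times> {..<p}"
    proof -
      have "nat (n mod int p) < p" for n
        using p pos_mod_bound[of "int p" n] pos_mod_sign[of "int p" n] by linarith
      then show ?thesis by (auto simp: g_def K_def)
    qed
    have "(\<Sum>n\<in>F. \<bar>laurent_entry p b a m n\<bar>) = (\<Sum>n\<in>F. (\<lambda>(k, j). \<bar>block p b a k i (j + 1)\<bar>) (g n))"
      by (simp add: laurent_entry_def g_def i_def)
    also have "\<dots> = (\<Sum>(k, j)\<in>g ` F. \<bar>block p b a k i (j + 1)\<bar>)"
      by (simp only: sum.reindex[OF inj] o_def)
    also have "\<dots> \<le> (\<Sum>(k, j)\<in>K \<times> {..<p}. \<bar>block p b a k i (j + 1)\<bar>)"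
      by (rule sum_mono2) (use K sub in auto)
    also have "\<dots> \<le> (\<Sum>(k, j)\<in>K \<times> {..<p}. (if k = 0 then \<beta> else 0) + \<bar>a (nat \<bar>k\<bar>)\<bar>)"
      by (rule sum_mono) (use bl[OF i] in auto)
    also have "\<dots> = real p * ((\<Sum>k\<in>K. if k = 0 then \<beta> else 0) + (\<Sum>k\<in>K. \<bar>a (nat \<bar>k\<bar>)\<bar>))"
      by (simp add: sum.cartesian_product[symmetric] sum_distrib_left[symmetric] sum.distrib[symmetric])
    also have "\<dots> \<le> real p * (\<beta> + 2 * (\<Sum>k. \<bar>a k\<bar>))"
      by (intro mult_left_mono add_mono suma K) (auto simp: sum.delta K \<beta>)
    finally show ?thesis .
  qed
  then show ?thesis using that by blast
qed

lemma laurent_operator_bounded: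
  assumes "p \<ge> 2" "summable (\<lambda>k. \<bar>a k\<bar>)"
  obtains C where
    "\<And>f m. f \<in> l2 \<Longrightarrow> (\<lambda>n. cmod (of_real (laurent_entry p b a m n) * f n)) summable_on UNIV"
    "\<And>f. f \<in> l2 \<Longrightarrow> laurent_operator p b a f \<in> l2"
    "\<And>f. f \<in> l2 \<Longrightarrow> l2_norm (laurent_operator p b a f) \<le> C * l2_norm f"
proof -
  obtain C where row: "\<And>m F. finite F \<Longrightarrow> (\<Sum>n\<in>F. \<bar>laurent_entry p b a m n\<bar>) \<le> C"
    using laurent_entry_row_sum[OF assms] by blast
  have col: "\<And>n F. finite F \<Longrightarrow> (\<Sum>m\<in>F. \<bar>laurent_entry p b a m n\<bar>) \<le> C"
    using row by (subst laurent_entry_sym)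
  have eq: "laurent_operator p b a f = (\<lambda>m. \<Sum>\<^sub>\<infinity>n. of_real (laurent_entry p b a m n) * f n)" for f
    by (simp add: fun_eq_iff laurent_operator_def)
  show ?thesis
    by (rule that[of C]; (unfold eq)?; rule l2_schur_test[OF row col])
qed

end

theory Submission
  imports Defs
begin

text \<open>Suppose that \<open>b k < b (k + 1)\<close> for some \<open>k\<close>. The two principal \<open>(p - 1) \<times> (p - 1)\<close> submatrices
obtained by deleting the last or the first row and column of a block are Jacobi matrices that do
not see the corner entries, with diagonals \<open>b 1, \<dots>, b (p - 1)\<close> and \<open>b 2, \<dots>, b p\<close>. Since \<open>b\<close>
increases, the second dominates the first, and strictly so on vectors without zero entries.

Let \<open>\<nu>\<close> be the least eigenvalue of the second submatrix. Its eigenvector has entries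
\<open>(-1) ^ r * c (r + 1)\<close> with \<open>c 1, \<dots>, c (p - 1) > 0\<close>; on this vector the quadratic form of the first submatrix is
smaller than \<open>\<nu>\<close> times the squared norm. So, with \<open>L\<close> the Laurent operator, there is \<open>l < \<nu>\<close>
such that the form of \<open>L - l\<close> is uniformly negative on the sequences that are in every block a multiple of this
vector with a last entry \<open>0\<close> appended, and uniformly positive on the sequences whose first entry
vanishes in every block. These two spaces together span everything because \<open>c 1 = 1\<close>. For
\<open>x = u + w\<close> in this decomposition, the symmetry of \<open>L\<close> gives
\<open>\<langle>(L - l) x, w - u\<rangle> = \<langle>(L - l) w, w\<rangle> - \<langle>(L - l) u, u\<rangle>\<close>, which bounds \<open>L - l\<close> below, and then \<open>L - z\<close>
for all \<open>z\<close> with \<open>Re z = l\<close>; these operators are invertible, hence Fredholm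
(\<open>form_gap\<close>, \<open>not_in_essential_spectrum\<close>).

On the other hand, the infimum and the supremum of the quadratic form of \<open>L\<close> on unit vectors lie
on different sides of \<open>l\<close>. Both are approximate eigenvalues, and since \<open>L\<close> commutes with
translations by whole blocks, every approximate eigenvector, cut off to finite support, has
infinitely many orthogonal copies, which puts both numbers in the essential spectrum (\<open>approximate_eigenvalue_in_essential_spectrum\<close>).
The line \<open>Re z = l\<close> therefore separates the essential spectrum.

The decomposition above uses the same vectors in every block, that is, it does not depend on the
argument of the symbol; this is why the whole argument can be carried out directly on sequences.\<close>

section \<open>Bounded symmetric operators on a real Hilbert space\<close>

text \<open>\<open>T T'\<close> is symmetric with \<open>\<langle>T T' y, y\<rangle> \<ge> c\<^sup>2 \<parallel>y\<parallel>\<^sup>2\<close>, so for \<open>K\<close> a bound of \<open>T\<close> the iteration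
\<open>y \<mapsto> y - (T T' y - h) / K\<^sup>2\<close> is a contraction, and its fixed point solves \<open>T (T' y) = h\<close>.\<close>

lemma surj_if_adjoint_bounded_below:
  fixes T T' :: "'a::{real_inner,banach} \<Rightarrow> 'a"
  assumes T: "bounded_linear T" and T': "bounded_linear T'"
    and adj: "\<And>x y. inner (T x) y = inner x (T' y)"
    and c: "c > 0" and below: "\<And>y. c * norm y \<le> norm (T' y)"
  shows "surj T"
proof -
  interpret T: bounded_linear T by fact
  interpret T': bounded_linear T' by fact
  obtain K0 where K0: "\<And>x. norm (T x) \<le> norm x * K0" "K0 > 0" using T.pos_bounded by blast
  \<comment> \<open>Adding \<open>c\<close> makes the contraction factor \<open>sqrt (1 - (c / K)\<^sup>2)\<close> well defined even on the trivial space.\<close>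
  define K where "K = K0 + c"
  have K: "K > 0" "c < K" "norm (T x) \<le> K * norm x" for x
    using K0 c by (auto simp: K_def algebra_simps intro: order_trans[OF K0(1)[of x]])
  define q where "q = sqrt (1 - (c / K)\<^sup>2)"
  have cK: "0 < (c / K)\<^sup>2" "(c / K)\<^sup>2 \<le> 1" using c K by (auto simp: power_le_one)
  have q: "0 \<le> q" "q < 1" "q\<^sup>2 = 1 - (c / K)\<^sup>2" using cK by (auto simp: q_def)
  have step: "norm (z - (1 / K\<^sup>2) *\<^sub>R T (T' z)) \<le> q * norm z" for z
  proof (rule power2_le_imp_le)
    have a: "inner (T (T' z)) z = (norm (T' z))\<^sup>2" by (simp add: adj power2_norm_eq_inner)
    have b: "(norm (T (T' z)))\<^sup>2 \<le> K\<^sup>2 * (norm (T' z))\<^sup>2"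
      using power_mono[OF K(3)[of "T' z"], of 2] by (simp add: power_mult_distrib)
    have d: "c\<^sup>2 * (norm z)\<^sup>2 \<le> (norm (T' z))\<^sup>2"
      using power_mono[OF below[of z], of 2] c by (simp add: power_mult_distrib)
    have expand: "(norm (z - s *\<^sub>R y))\<^sup>2 = (norm z)\<^sup>2 - 2 * s * inner y z + s\<^sup>2 * (norm y)\<^sup>2"
      for s and y :: 'a
      unfolding power2_norm_eq_inner by (simp add: inner_commute power2_eq_square algebra_simps)
    have "(norm (z - (1 / K\<^sup>2) *\<^sub>R T (T' z)))\<^sup>2
        = (norm z)\<^sup>2 - 2 / K\<^sup>2 * inner (T (T' z)) z + (1 / K\<^sup>2)\<^sup>2 * (norm (T (T' z)))\<^sup>2"
      unfolding expand by simp
    also have "\<dots> \<le> (norm z)\<^sup>2 - 2 / K\<^sup>2 * (norm (T' z))\<^sup>2 + (1 / K\<^sup>2)\<^sup>2 * (K\<^sup>2 * (norm (T' z))\<^sup>2)"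
      unfolding a by (intro add_mono order_refl mult_left_mono b) auto
    also have "\<dots> = (norm z)\<^sup>2 - (1 / K\<^sup>2) * (norm (T' z))\<^sup>2"
      using K(1) by (simp add: field_simps power2_eq_square)
    also have "\<dots> \<le> (norm z)\<^sup>2 - (1 / K\<^sup>2) * (c\<^sup>2 * (norm z)\<^sup>2)"
      by (intro diff_mono order_refl mult_left_mono d) auto
    also have "\<dots> = (q * norm z)\<^sup>2"
      unfolding power_mult_distrib q(3) by (simp add: algebra_simps power_divide)
    finally show "(norm (z - (1 / K\<^sup>2) *\<^sub>R T (T' z)))\<^sup>2 \<le> (q * norm z)\<^sup>2" .
  qed (use q in simp)
  show ?thesis
  proof (rule surjI)
    fix h
    define F where "F y = y - (1 / K\<^sup>2) *\<^sub>R (T (T' y) - h)" for y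
    have "F x - F y = (x - y) - (1 / K\<^sup>2) *\<^sub>R T (T' (x - y))" for x y
      by (simp add: F_def T.diff T'.diff algebra_simps)
    then have "\<exists>!y. F y = y"
      by (intro banach_fix_type[OF q(1,2)]) (auto simp: dist_norm step)
    then have "\<exists>y. T (T' y) = h" using K by (auto simp: F_def)
    then show "T (T' (SOME y. T (T' y) = h)) = h" by (rule someI_ex)
  qed
qed

text \<open>Put \<open>B = T - t\<close>. Since its form is nonnegative, a Cauchy-Schwarz argument for that form gives
\<open>\<parallel>B x\<parallel>\<^sup>2 \<le> K \<langle>B x, x\<rangle>\<close>: vectors that nearly minimise the form are nearly eigenvectors.\<close>

lemma approximate_eigenvector_at_form_minimum:
  fixes T :: "'a::real_inner \<Rightarrow> 'a"
  assumes T: "bounded_linear T" and sym: "\<And>x y. inner (T x) y = inner x (T y)"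
    and low: "\<And>x. norm x = 1 \<Longrightarrow> t \<le> inner (T x) x"
    and approx: "\<And>e. e > 0 \<Longrightarrow> \<exists>x. norm x = 1 \<and> inner (T x) x < t + e"
    and e: "e > 0"
  shows "\<exists>x. norm x = 1 \<and> norm (T x - t *\<^sub>R x) < e"
proof -
  define B where "B x = T x - t *\<^sub>R x" for x
  have "bounded_linear B" unfolding B_def
    by (intro bounded_linear_sub T bounded_linear_scaleR_right)
  then interpret B: bounded_linear B .
  obtain K where K: "\<And>x. norm (B x) \<le> norm x * K" "K > 0" using B.pos_bounded by blast
  have symB: "inner (B x) y = inner x (B y)" for x y by (simp add: B_def inner_diff sym)
  have pos: "0 \<le> inner (B x) x" for x
  proof (cases "x = 0")
    case False
    have "t \<le> inner (T (x /\<^sub>R norm x)) (x /\<^sub>R norm x)" using False by (intro low) simp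
    also have "\<dots> = inner (T x) x / (norm x)\<^sup>2"
      by (simp add: linear_simps[OF T] power2_eq_square divide_simps)
    finally show ?thesis using False
      by (simp add: B_def inner_diff power2_norm_eq_inner field_simps)
  qed simp
  have CS: "(norm (B x))\<^sup>2 \<le> K * inner (B x) x" for x
  proof -
    have bb: "inner (B (B x)) (B x) \<le> K * (norm (B x))\<^sup>2"
    proof -
      have "inner (B (B x)) (B x) \<le> norm (B (B x)) * norm (B x)" by (rule norm_cauchy_schwarz)
      also have "\<dots> \<le> (norm (B x) * K) * norm (B x)" by (intro mult_right_mono K) auto
      finally show ?thesis by (simp add: power2_eq_square mult_ac)
    qed
    \<comment> \<open>With step \<open>1 / K\<close> the bound for the quadratic term is half of the linear term.\<close>
    have "0 \<le> inner (B (x - (1 / K) *\<^sub>R B x)) (x - (1 / K) *\<^sub>R B x)" by (rule pos)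
    also have "\<dots> = inner (B x) x - 2 * (1 / K) * inner (B x) (B x)
        + (1 / K)\<^sup>2 * inner (B (B x)) (B x)"
      unfolding B.diff B.scaleR inner_diff_left inner_diff_right inner_scaleR_left
        inner_scaleR_right symB[of "B x" x] by (simp add: power2_eq_square inner_commute algebra_simps)
    also have "\<dots> = inner (B x) x - 2 / K * (norm (B x))\<^sup>2 + (1 / K)\<^sup>2 * inner (B (B x)) (B x)"
      by (simp add: power2_norm_eq_inner)
    also have "\<dots> \<le> inner (B x) x - 2 / K * (norm (B x))\<^sup>2 + (1 / K)\<^sup>2 * (K * (norm (B x))\<^sup>2)"
      by (intro add_mono order_refl mult_left_mono bb) auto
    also have "\<dots> = inner (B x) x - (norm (B x))\<^sup>2 / K"
      using K(2) by (simp add: field_simps power2_eq_square)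
    finally show ?thesis using K(2) by (simp add: field_simps)
  qed
  have "e\<^sup>2 / K > 0" using e K(2) by simp
  from approx[OF this] obtain x where x: "norm x = 1" "inner (T x) x < t + e\<^sup>2 / K" by blast
  have "inner (B x) x < e\<^sup>2 / K"
    using x by (simp add: B_def inner_diff flip: power2_norm_eq_inner)
  then have "(norm (B x))\<^sup>2 < e\<^sup>2"
    using CS[of x] K(2) by (simp add: field_simps)
  then have "norm (B x) < e" using e by (simp add: power2_less_imp_less)
  then show ?thesis using x(1) by (auto simp: B_def)
qed

text \<open>The approximate eigenvalue is the infimum of the quadratic form on unit vectors.\<close>

lemma approximate_eigenvalue_below:
  fixes T :: "'a::real_inner \<Rightarrow> 'a"
  assumes T: "bounded_linear T" and sym: "\<And>x y. inner (T x) y = inner x (T y)"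
    and x0: "inner (T x0) x0 < l * (norm x0)\<^sup>2"
  shows "\<exists>t<l. \<forall>e>0. \<exists>x. norm x = 1 \<and> norm (T x - t *\<^sub>R x) < e"
proof -
  obtain K where K: "\<And>x. norm (T x) \<le> norm x * K" using bounded_linear.bounded[OF T] by blast
  define V where "V = {inner (T x) x | x. norm x = 1}"
  have bdd: "bdd_below V"
  proof (rule bdd_belowI)
    fix v assume "v \<in> V"
    then obtain x where x: "norm x = 1" "v = inner (T x) x" by (auto simp: V_def)
    then show "- K \<le> v" using Cauchy_Schwarz_ineq2[of "T x" x] K[of x] by simp
  qed
  have n0: "norm x0 > 0" using x0 by (auto simp: linear_simps[OF T])
  define e0 where "e0 = x0 /\<^sub>R norm x0"
  have e0: "norm e0 = 1" "inner (T e0) e0 < l"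
    using n0 x0 by (simp_all add: e0_def linear_simps[OF T] power2_eq_square divide_simps mult_ac)
  then have inV: "inner (T e0) e0 \<in> V" by (auto simp: V_def)
  define t where "t = Inf V"
  have "t < l" using cInf_lower[OF inV bdd] e0 by (simp add: t_def)
  moreover have "\<exists>x. norm x = 1 \<and> norm (T x - t *\<^sub>R x) < e" if "e > 0" for e
  proof (rule approximate_eigenvector_at_form_minimum[OF T sym _ _ that])
    show "t \<le> inner (T x) x" if "norm x = 1" for x
      unfolding t_def using that by (intro cInf_lower bdd) (auto simp: V_def)
    fix d :: real assume "d > 0"
    then have "Inf V < t + d" by (simp add: t_def)
    then obtain v where "v \<in> V" "v < t + d" using cInf_lessD[of V] inV by blast
    then show "\<exists>x. norm x = 1 \<and> inner (T x) x < t + d" by (auto simp: V_def)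
  qed
  ultimately show ?thesis by blast
qed

text \<open>The defects of \<open>N > card B\<close> vectors modulo \<open>M\<close> lie in a space of dimension at most \<open>card B\<close>, hence
are linearly dependent.\<close>

lemma combination_in_finite_codimension:
  fixes M :: "'a::real_vector set" and g :: "nat \<Rightarrow> 'a"
  assumes M: "subspace M" and B: "finite B" and cod: "\<And>x. \<exists>m\<in>M. x - m \<in> span B"
    and N: "N > card B"
  shows "\<exists>c. (\<exists>i<N. c i \<noteq> 0) \<and> (\<Sum>i<N. c i *\<^sub>R g i) \<in> M"
proof -
  have "\<forall>i. \<exists>m. m \<in> M \<and> g i - m \<in> span B" using cod by blast
  then obtain m where m: "\<And>i. m i \<in> M" "\<And>i. g i - m i \<in> span B" by metis
  define s where "s i = g i - m i" for i
  have "\<exists>c. (\<exists>i<N. c i \<noteq> 0) \<and> (\<Sum>i<N. c i *\<^sub>R s i) = 0"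
  proof (cases "inj_on s {..<N}")
    case True
    have "card (s ` {..<N}) = N" using True by (simp add: card_image)
    then have "dependent (s ` {..<N})"
      using independent_span_bound[OF B, of "s ` {..<N}"] m N by (force simp: s_def)
    then obtain u where u: "\<exists>v\<in>s ` {..<N}. u v \<noteq> 0" "(\<Sum>v\<in>s ` {..<N}. u v *\<^sub>R v) = 0"
      by (auto simp: dependent_finite)
    have "(\<Sum>i<N. u (s i) *\<^sub>R s i) = 0" using u(2) True by (simp add: sum.reindex)
    then show ?thesis using u(1) by (intro exI[of _ "\<lambda>i. u (s i)"]) auto
  next
    case False
    then obtain i j where ij: "i < N" "j < N" "i \<noteq> j" "s i = s j" by (auto simp: inj_on_def)
    have "(\<Sum>k<N. ((if k = i then 1 else 0) - (if k = j then 1 else 0)) *\<^sub>R s k)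
        = (\<Sum>k<N. (if k = i then s k else 0)) - (\<Sum>k<N. if k = j then s k else 0)"
      by (subst sum_subtractf[symmetric]) (auto intro!: sum.cong simp: algebra_simps)
    also have "\<dots> = 0" using ij by simp
    finally show ?thesis using ij
      by (intro exI[of _ "\<lambda>k. (if k = i then 1 else 0) - (if k = j then 1 else 0)"]) auto
  qed
  then obtain c where c: "\<exists>i<N. c i \<noteq> 0" "(\<Sum>i<N. c i *\<^sub>R s i) = 0" by blast
  have "(\<Sum>i<N. c i *\<^sub>R g i) = (\<Sum>i<N. c i *\<^sub>R s i) + (\<Sum>i<N. c i *\<^sub>R m i)"
    by (simp add: s_def scaleR_diff_right sum_subtractf)
  also have "\<dots> \<in> M" using c(2) m(1) M by (auto intro: subspace_sum subspace_scale)
  finally show ?thesis using c(1) by blast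
qed

text \<open>A gliding hump argument. By the previous lemma there are orthonormal vectors \<open>m n\<close> in the range of
\<open>A\<close> with \<open>\<parallel>A (m n)\<parallel> \<le> (1/4) ^ n\<close>. The series of \<open>2 ^ n A (m n)\<close> converges, and its sum is \<open>A f\<close> for some
\<open>f\<close> because the range is closed. Testing against \<open>y\<close> with \<open>A y = m k\<close> yields
\<open>\<langle>f, m k\<rangle> = \<langle>A f, y\<rangle> = 2 ^ k\<close> for every \<open>k\<close>, which is impossible. Since each \<open>m n\<close> is to be
orthogonal to the finitely many earlier ones, the hypothesis provides orthonormal families
orthogonal to any finite subset of \<open>D\<close>, and \<open>D\<close> is a subspace so that it contains each \<open>m n\<close>.\<close>

lemma no_singular_sequence_if_closed_range_finite_codimension:
  fixes A :: "'a::{real_inner,banach} \<Rightarrow> 'a"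
  assumes A: "bounded_linear A" and sym: "\<And>x y. inner (A x) y = inner x (A y)"
    and closed: "closed (range A)" and B: "finite B"
    and cod: "\<And>x. \<exists>y. x - A y \<in> span B"
    and D: "subspace D"
    and sing: "\<And>N F e. \<lbrakk>finite F; F \<subseteq> D; e > 0\<rbrakk> \<Longrightarrow> \<exists>g :: nat \<Rightarrow> 'a. \<forall>i<N. g i \<in> D \<and> norm (g i) = 1 \<and>
      norm (A (g i)) \<le> e \<and> (\<forall>f\<in>F. inner (g i) f = 0) \<and> (\<forall>j<N. j \<noteq> i \<longrightarrow> inner (g i) (g j) = 0)"
  shows False
proof -
  interpret A: bounded_linear A by fact
  have subM: "subspace (range A)"
    by (rule linear_subspace_image[OF A.linear_axioms subspace_UNIV])
  have one: "\<exists>m\<in>D. norm m = 1 \<and> m \<in> range A \<and> norm (A m) \<le> e \<and> (\<forall>f\<in>F. inner m f = 0)"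
    if F: "finite F" "F \<subseteq> D" and e: "e > 0" for F and e :: real
  proof -
    define N where "N = Suc (card B)"
    have N: "N > card B" "real N > 0" by (simp_all add: N_def)
    have "e / real N > 0" using e N by simp
    from sing[OF F this, of N] obtain g :: "nat \<Rightarrow> 'a" where
      g: "\<And>i. i < N \<Longrightarrow> g i \<in> D" "\<And>i. i < N \<Longrightarrow> norm (g i) = 1"
        "\<And>i. i < N \<Longrightarrow> norm (A (g i)) \<le> e / real N"
        "\<And>i f. i < N \<Longrightarrow> f \<in> F \<Longrightarrow> inner (g i) f = 0"
        "\<And>i j. i < N \<Longrightarrow> j < N \<Longrightarrow> j \<noteq> i \<Longrightarrow> inner (g i) (g j) = 0" by blast
    have "\<exists>m\<in>range A. x - m \<in> span B" for x using cod[of x] by auto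
    from combination_in_finite_codimension[OF subM B this N(1), of g]
    obtain c where c: "\<exists>i<N. c i \<noteq> 0" "(\<Sum>i<N. c i *\<^sub>R g i) \<in> range A" by blast
    define v where "v = (\<Sum>i<N. c i *\<^sub>R g i)"
    have vg: "inner v (g j) = c j" if "j < N" for j
    proof -
      have "inner v (g j) = (\<Sum>i<N. c i * inner (g i) (g j))" by (simp add: v_def inner_sum_left)
      also have "\<dots> = (\<Sum>i<N. if i = j then c i else 0)"
        using g(2)[OF that] g(5) that
        by (intro sum.cong refl) (auto simp flip: power2_norm_eq_inner)
      finally show ?thesis using that by simp
    qed
    have v0: "v \<noteq> 0" using c(1) vg by force
    have cv: "\<bar>c i\<bar> \<le> norm v" if "i < N" for i
      using Cauchy_Schwarz_ineq2[of v "g i"] vg[OF that] g(2)[OF that] by simp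
    have "norm (A v) \<le> (\<Sum>i<N. norm (c i *\<^sub>R A (g i)))"
      unfolding v_def A.sum A.scaleR by (rule norm_sum)
    also have "\<dots> \<le> (\<Sum>i<N. norm v * (e / real N))"
      unfolding norm_scaleR by (intro sum_mono mult_mono cv g) auto
    also have "\<dots> = norm v * e" using N by simp
    finally have Av: "norm (A v) \<le> norm v * e" .
    have vD: "v \<in> D" unfolding v_def by (intro subspace_sum subspace_scale D g) auto
    show ?thesis
    proof (intro bexI conjI ballI)
      show "v /\<^sub>R norm v \<in> D" by (intro subspace_scale D vD)
      show "norm (v /\<^sub>R norm v) = 1" using v0 by simp
      show "v /\<^sub>R norm v \<in> range A" using c(2) by (intro subspace_scale subM) (simp add: v_def)
      show "norm (A (v /\<^sub>R norm v)) \<le> e" using Av v0 by (simp add: A.scaleR field_simps)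
      fix f assume "f \<in> F"
      then have "inner v f = 0" by (simp add: v_def inner_sum_left g(4))
      then show "inner (v /\<^sub>R norm v) f = 0" by simp
    qed
  qed
  have "\<exists>m. \<forall>n. m n \<in> D \<and> norm (m n) = 1 \<and> m n \<in> range A \<and> norm (A (m n)) \<le> (1/4)^n \<and>
      (\<forall>f\<in>m ` {..<n}. inner (m n) f = 0)"
  proof (rule dependent_wf_choice[OF wf_less_than])
    fix n and m :: "nat \<Rightarrow> 'a"
    assume "\<And>k. (k, n) \<in> less_than \<Longrightarrow> m k \<in> D \<and> norm (m k) = 1 \<and> m k \<in> range A \<and>
      norm (A (m k)) \<le> (1/4)^k \<and> (\<forall>f\<in>m ` {..<k}. inner (m k) f = 0)"
    then show "\<exists>r. r \<in> D \<and> norm r = 1 \<and> r \<in> range A \<and> norm (A r) \<le> (1/4)^n \<and>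
      (\<forall>f\<in>m ` {..<n}. inner r f = 0)"
      using one[of "m ` {..<n}" "(1/4)^n"] by auto
  qed auto
  then obtain m where m: "\<And>n. norm (m n) = 1" "\<And>n. m n \<in> range A"
    "\<And>n. norm (A (m n)) \<le> (1/4)^n" and lt: "\<And>n j. j < n \<Longrightarrow> inner (m n) (m j) = 0" by blast
  have orth: "inner (m n) (m j) = (if n = j then 1 else 0)" for n j
    using lt[of n j] lt[of j n] m(1)[of n]
    by (cases n j rule: linorder_cases) (auto simp: inner_commute simp flip: power2_norm_eq_inner)
  define a where "a n = 2 ^ n *\<^sub>R A (m n)" for n
  have na: "norm (a n) \<le> (1/2)^n" for n
  proof -
    have "norm (a n) \<le> 2 ^ n * (1/4)^n" unfolding a_def by (simp add: m(3))
    also have "\<dots> = (2 * (1/4)) ^ n" by (simp only: power_mult_distrib)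
    finally show ?thesis by simp
  qed
  have "summable a"
    by (rule summable_comparison_test'[of "\<lambda>n. (1/2)^n" 0])
       (use na in \<open>auto intro: summable_geometric\<close>)
  then have lim: "(\<lambda>n. \<Sum>i<n. a i) \<longlonglongrightarrow> suminf a" by (rule summable_LIMSEQ)
  have "suminf a \<in> range A"
  proof (rule closed_sequentially[OF closed _ lim])
    show "(\<Sum>i<n. a i) \<in> range A" for n unfolding a_def
      by (intro subspace_sum subspace_scale subM) auto
  qed
  then obtain f where f: "A f = suminf a" by auto
  have "2 ^ k \<le> norm f" for k
  proof -
    obtain y where y: "m k = A y" using m(2) by blast
    have "inner (a n) y = (if n = k then 2 ^ k else 0)" for n
      using orth[of n k] by (simp add: a_def sym flip: y)
    moreover have "(\<lambda>n. inner (a n) y) sums inner (suminf a) y"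
      by (intro bounded_linear.sums[OF bounded_linear_inner_left] summable_sums \<open>summable a\<close>)
    ultimately have "inner (suminf a) y = 2 ^ k"
      using sums_unique2[OF _ sums_single[of k "\<lambda>_. 2 ^ k"]] by simp
    then have "inner f (m k) = 2 ^ k" by (simp add: y flip: sym f)
    then show ?thesis using Cauchy_Schwarz_ineq2[of f "m k"] m(1)[of k] by simp
  qed
  then show False
    using real_arch_pow[of 2 "norm f"] by (meson not_less one_less_numeral_iff semiring_norm(76))
qed

section \<open>Square-summable sequences as a Hilbert space\<close>

text \<open>The set \<^term>\<open>l2\<close> becomes a type so that the norm, the completeness and the linear algebra of type
classes apply. Only the real Hilbert space structure is recorded, with the real part of the usual
inner product; complex scalars enter through \<open>mult_i\<close> below.\<close>

typedef ell2 = l2 morphisms coord of_seq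
  by (rule exI[of _ "\<lambda>_. 0"]) (simp add: l2_def)

setup_lifting type_definition_ell2

lemma l2_scale:
  assumes "f \<in> l2"
  shows "(\<lambda>i. c * f i) \<in> l2"
  using assms by (auto simp: l2_def norm_mult power_mult_distrib intro: summable_on_cmult_right)

lemma l2_inner_summable:
  assumes "f \<in> l2" "g \<in> l2"
  shows "(\<lambda>i. norm (inner (f i) (g i))) summable_on UNIV"
proof (rule Infinite_Sum.abs_summable_on_comparison_test')
  show "(\<lambda>i. (cmod (f i))\<^sup>2 + (cmod (g i))\<^sup>2) summable_on UNIV"
    using assms by (intro summable_on_add) (auto simp: l2_def)
  fix i
  have "norm (inner (f i) (g i)) \<le> norm (f i) * norm (g i)"
    using Cauchy_Schwarz_ineq2 by simp
  also have "2 * \<dots> \<le> (cmod (f i))\<^sup>2 + (cmod (g i))\<^sup>2" using sum_squares_bound by (simp add: mult.assoc)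
  finally show "norm (inner (f i) (g i)) \<le> (cmod (f i))\<^sup>2 + (cmod (g i))\<^sup>2"
    by (smt (verit) zero_le_power2)
qed

instantiation ell2 :: real_vector
begin

lift_definition zero_ell2 :: ell2 is "\<lambda>_. 0" by (simp add: l2_def)
lift_definition plus_ell2 :: "ell2 \<Rightarrow> ell2 \<Rightarrow> ell2" is "\<lambda>f g i. f i + g i"
  using l2_add(1) by (simp add: plus_fun_def)
lift_definition minus_ell2 :: "ell2 \<Rightarrow> ell2 \<Rightarrow> ell2" is "\<lambda>f g i. f i - g i"
  using l2_diff by (simp add: fun_diff_def)
lift_definition uminus_ell2 :: "ell2 \<Rightarrow> ell2" is "\<lambda>f i. - f i"
  using l2_uminus(1) by (simp add: l2_def)
lift_definition scaleR_ell2 :: "real \<Rightarrow> ell2 \<Rightarrow> ell2" is "\<lambda>r f i. r *\<^sub>R f i"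
  using l2_scale by (simp add: scaleR_conv_of_real)

instance
  by standard (transfer; simp add: fun_eq_iff algebra_simps)+

end

instantiation ell2 :: real_inner
begin

definition "inner x y = (\<Sum>\<^sub>\<infinity>i. inner (coord x i) (coord y i))" for x y :: ell2
definition "norm x = sqrt (inner x x)" for x :: ell2
definition "dist x y = norm (x - y)" for x y :: ell2
definition "sgn x = x /\<^sub>R norm x" for x :: ell2
definition "(uniformity :: (ell2 \<times> ell2) filter) = (INF e\<in>{0<..}. principal {(x, y). dist x y < e})"
definition "open S \<longleftrightarrow> (\<forall>x\<in>S. \<forall>\<^sub>F (x', y) in uniformity. x' = x \<longrightarrow> y \<in> S)" for S :: "ell2 set"

instance
proof
  fix x y z :: ell2 and r s :: real
  have summ: "(\<lambda>i. inner (coord u i) (coord v i)) summable_on UNIV" for u v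
    by (rule abs_summable_summable[OF l2_inner_summable[OF coord coord]])
  show "sgn x = x /\<^sub>R norm x" "dist x y = norm (x - y)" "norm x = sqrt (inner x x)"
    "(uniformity :: (ell2 \<times> ell2) filter) = (INF e\<in>{0<..}. principal {(x, y). dist x y < e})"
    by (simp_all add: sgn_ell2_def dist_ell2_def norm_ell2_def uniformity_ell2_def)
  show "open S \<longleftrightarrow> (\<forall>x\<in>S. \<forall>\<^sub>F (x', y) in uniformity. x' = x \<longrightarrow> y \<in> S)" for S :: "ell2 set"
    by (simp add: open_ell2_def)
  show "inner x y = inner y x" by (simp add: inner_ell2_def inner_commute)
  show "inner (x + y) z = inner x z + inner y z"
    using infsum_add[OF summ[of x z] summ[of y z]]
    by (simp add: inner_ell2_def plus_ell2.rep_eq inner_add_left)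
  show "inner (r *\<^sub>R x) y = r * inner x y"
    by (simp add: inner_ell2_def scaleR_ell2.rep_eq infsum_cmult_right')
  show "0 \<le> inner x x" by (simp add: inner_ell2_def infsum_nonneg)
  show "inner x x = 0 \<longleftrightarrow> x = 0"
  proof
    assume "inner x x = 0"
    then have "coord x i = 0" for i
      using nonneg_infsum_le_0D[OF _ summ[of x x], of i] by (simp add: inner_ell2_def)
    then show "x = 0" by (simp add: coord_inject[symmetric] zero_ell2.rep_eq fun_eq_iff)
  qed (simp add: inner_ell2_def zero_ell2.rep_eq)
qed

end

lemmas coord_simps [simp] = zero_ell2.rep_eq plus_ell2.rep_eq minus_ell2.rep_eq
  uminus_ell2.rep_eq scaleR_ell2.rep_eq

lemma ell2_eqI: "(\<And>i. coord x i = coord y i) \<Longrightarrow> x = y"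
  by (simp add: coord_inject[symmetric] fun_eq_iff)

lemma coord_of_seq [simp]: "f \<in> l2 \<Longrightarrow> coord (of_seq f) = f"
  by (rule of_seq_inverse)

lemma norm_ell2_conv_l2_norm: "norm x = l2_norm (coord x)"
  by (simp add: norm_ell2_def inner_ell2_def l2_norm_def power2_norm_eq_inner)

lemma dist_ell2_conv_l2_dist: "dist x y = l2_dist (coord x) (coord y)"
  by (simp add: dist_norm norm_ell2_conv_l2_norm l2_dist_def fun_diff_def)

lemma inner_ell2_has_sum: "((\<lambda>i. inner (coord x i) (coord y i)) has_sum inner x y) UNIV"
  unfolding inner_ell2_def
  by (rule has_sum_infsum[OF abs_summable_summable[OF l2_inner_summable[OF coord coord]]])

lemma norm2_ell2_has_sum: "((\<lambda>i. (cmod (coord x i))\<^sup>2) has_sum (norm x)\<^sup>2) UNIV"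
  using inner_ell2_has_sum[of x x] by (simp add: power2_norm_eq_inner)

lemma norm_coord_le: "cmod (coord x i) \<le> norm x"
  using l2_finite_bound[OF coord, of "{i}" x] by (simp add: norm_ell2_conv_l2_norm)

instance ell2 :: banach
proof
  fix X :: "nat \<Rightarrow> ell2" assume X: "Cauchy X"
  have "Cauchy (\<lambda>n. coord (X n) i)" for i
  proof (rule metric_CauchyI)
    fix e :: real assume "e > 0"
    then obtain M where "\<forall>m\<ge>M. \<forall>n\<ge>M. dist (X m) (X n) < e" using metric_CauchyD[OF X] by blast
    moreover have "dist (coord (X m) i) (coord (X n) i) \<le> dist (X m) (X n)" for m n
      using norm_coord_le[of "X m - X n" i] by (simp add: dist_norm)
    ultimately show "\<exists>M. \<forall>m\<ge>M. \<forall>n\<ge>M. dist (coord (X m) i) (coord (X n) i) < e"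
      by (meson le_less_trans)
  qed
  define l where "l i = lim (\<lambda>n. coord (X n) i)" for i
  have l: "(\<lambda>n. coord (X n) i) \<longlonglongrightarrow> l i" for i
    using \<open>Cauchy (\<lambda>n. coord (X n) i)\<close> by (simp add: l_def Cauchy_convergent_iff convergent_LIMSEQ_iff)
  have key: "(\<lambda>i. coord (X n) i - l i) \<in> l2 \<and> l2_norm (\<lambda>i. coord (X n) i - l i) \<le> e"
    if "\<And>m. m \<ge> M \<Longrightarrow> dist (X n) (X m) \<le> e" for M n e
  proof -
    have "L2_set (\<lambda>i. cmod (coord (X n) i - l i)) F \<le> e" if F: "finite F" for F
    proof (rule tendsto_upperbound)
      show "(\<lambda>m. L2_set (\<lambda>i. cmod (coord (X n) i - coord (X m) i)) F)
          \<longlonglongrightarrow> L2_set (\<lambda>i. cmod (coord (X n) i - l i)) F"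
        unfolding L2_set_def by (intro tendsto_intros l)
      have "L2_set (\<lambda>i. cmod (coord (X n) i - coord (X m) i)) F \<le> e" if "m \<ge> M" for m
        using l2_finite_bound[OF coord F, of "X n - X m"] \<open>\<And>m. m \<ge> M \<Longrightarrow> dist (X n) (X m) \<le> e\<close>[OF that]
        by (simp add: dist_norm norm_ell2_conv_l2_norm minus_ell2.rep_eq[abs_def])
      then show "\<forall>\<^sub>F m in sequentially. L2_set (\<lambda>i. cmod (coord (X n) i - coord (X m) i)) F \<le> e"
        by (auto simp: eventually_sequentially)
    qed simp
    from l2_boundI[OF this] show ?thesis by blast
  qed
  have cau: "\<exists>M. \<forall>n\<ge>M. (\<lambda>i. coord (X n) i - l i) \<in> l2 \<and> l2_norm (\<lambda>i. coord (X n) i - l i) \<le> e"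
    if "e > 0" for e
    using metric_CauchyD[OF X that] key by (meson less_imp_le)
  from cau[of 1] obtain n where "(\<lambda>i. coord (X n) i - l i) \<in> l2" by auto
  from l2_diff[OF coord[of "X n"] this] have l2: "l \<in> l2" by (simp add: fun_diff_def)
  have "X \<longlonglongrightarrow> of_seq l"
  proof (rule metric_LIMSEQ_I)
    fix e :: real assume "e > 0"
    then have "e / 2 > 0" by simp
    from cau[OF this] obtain M where "\<forall>n\<ge>M. l2_norm (\<lambda>i. coord (X n) i - l i) \<le> e / 2" by blast
    moreover have "dist (X n) (of_seq l) = l2_norm (\<lambda>i. coord (X n) i - l i)" for n
      unfolding dist_ell2_conv_l2_dist l2_dist_def coord_of_seq[OF l2] fun_diff_def ..
    moreover have "e / 2 < e" using \<open>e > 0\<close> by simp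
    ultimately show "\<exists>M. \<forall>n\<ge>M. dist (X n) (of_seq l) < e" by (metis le_less_trans)
  qed
  then show "convergent X" by (auto simp: convergent_def)
qed

definition mult_i :: "ell2 \<Rightarrow> ell2" where "mult_i x = of_seq (\<lambda>i. \<i> * coord x i)"

lemma coord_mult_i [simp]: "coord (mult_i x) i = \<i> * coord x i"
  using coord_of_seq[OF l2_scale[OF coord, of "\<i>" x]] by (simp add: mult_i_def)

text \<open>The bijection covers translations of the index as well as pointwise comparison.\<close>

lemma norm_ell2_leI:
  assumes "\<And>i. cmod (coord x i) \<le> cmod (coord y (g i))" "bij g"
  shows "norm x \<le> norm y"
proof -
  have "((\<lambda>i. (cmod (coord y (g i)))\<^sup>2) has_sum (norm y)\<^sup>2) UNIV"
    by (rule has_sum_reindex_bij_betw[OF assms(2), THEN iffD2, OF norm2_ell2_has_sum])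
  from has_sum_mono[OF norm2_ell2_has_sum[of x] this] assms(1)
  have "(norm x)\<^sup>2 \<le> (norm y)\<^sup>2" by (simp add: power_mono)
  then show ?thesis by (rule power2_le_imp_le) simp
qed

lemma bounded_linear_mult_i: "bounded_linear mult_i"
proof (rule bounded_linear_intro[where K = 1])
  show "norm (mult_i x) \<le> norm x * 1" for x
    using norm_ell2_leI[of "mult_i x" x id] by (simp add: norm_mult)
  show "mult_i (x + y) = mult_i x + mult_i y" for x y
    by (rule ell2_eqI) (simp add: ring_distribs)
  show "mult_i (r *\<^sub>R x) = r *\<^sub>R mult_i x" for r x
    by (rule ell2_eqI) simp
qed

lemma inner_mult_i: "inner (mult_i x) y = - inner x (mult_i y)"
proof -
  have "inner (coord (mult_i x) i) (coord y i) = - inner (coord x i) (coord (mult_i y) i)" for i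
    by (simp add: inner_complex_def)
  then show ?thesis by (simp add: inner_ell2_def infsum_uminus)
qed

lemma norm_mult_i [simp]: "norm (mult_i x) = norm x"
proof -
  have "mult_i (mult_i x) = - x" by (rule ell2_eqI) simp
  then have "inner (mult_i x) (mult_i x) = inner x x" using inner_mult_i[of x "mult_i x"] by simp
  then show ?thesis unfolding norm_eq_sqrt_inner by simp
qed

definition shift :: "int \<Rightarrow> ell2 \<Rightarrow> ell2" where "shift k x = of_seq (\<lambda>i. coord x (i - k))"

lemma bij_translation: "bij (\<lambda>i::int. i + k)" "bij (\<lambda>i::int. i - k)"
  by (auto intro: o_bij[of "\<lambda>i. i - k"] o_bij[of "\<lambda>i. i + k"] simp: fun_eq_iff)

lemma has_sum_translation:
  "((\<lambda>i::int. f (i + k)) has_sum s) UNIV \<longleftrightarrow> (f has_sum s) UNIV"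
  "((\<lambda>i::int. f (i - k)) has_sum s) UNIV \<longleftrightarrow> (f has_sum s) UNIV"
  using has_sum_reindex_bij_betw[OF bij_translation(1), of f k s]
    has_sum_reindex_bij_betw[OF bij_translation(2), of f k s] by auto

lemma coord_shift [simp]: "coord (shift k x) i = coord x (i - k)"
proof -
  have "(\<lambda>i. (cmod (coord x (i - k)))\<^sup>2) summable_on UNIV"
    using norm2_ell2_has_sum[of x] has_sum_translation(2)[of "\<lambda>i. (cmod (coord x i))\<^sup>2" k]
    by (auto simp: summable_on_def)
  then have "(\<lambda>i. coord x (i - k)) \<in> l2" by (simp add: l2_def)
  then show ?thesis by (simp add: shift_def)
qed

lemma norm_shift [simp]: "norm (shift k x) = norm x"
  using norm_ell2_leI[of "shift k x" x "\<lambda>i. i - k"] norm_ell2_leI[of x "shift k x" "\<lambda>i. i + k"]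
  by (simp add: bij_translation)

definition finite_support :: "ell2 set" where
  "finite_support = {x. finite {i. coord x i \<noteq> 0}}"

lemma subspace_finite_support: "subspace finite_support"
proof (rule subspaceI)
  fix x y :: ell2 and c :: real assume x: "x \<in> finite_support" 
  show "c *\<^sub>R x \<in> finite_support"
    using x unfolding finite_support_def by (auto elim: finite_subset[rotated])
  assume "y \<in> finite_support"
  then have "finite ({i. coord x i \<noteq> 0} \<union> {i. coord y i \<noteq> 0})" using x by (simp add: finite_support_def)
  then show "x + y \<in> finite_support"
    unfolding finite_support_def mem_Collect_eq by (rule finite_subset[rotated]) auto
qed (simp add: finite_support_def)

text \<open>Cutting off all coordinates outside a finite set leaves the tail of the convergent sum of squares.\<close>

lemma finite_support_dense:
  assumes "e > 0"
  shows "\<exists>y\<in>finite_support. norm (x - y) < e"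
proof -
  have "((\<lambda>F. \<Sum>i\<in>F. (cmod (coord x i))\<^sup>2) \<longlongrightarrow> (norm x)\<^sup>2) (finite_subsets_at_top UNIV)"
    using norm2_ell2_has_sum[of x] by (simp add: has_sum_def)
  then have "\<forall>\<^sub>F F in finite_subsets_at_top UNIV. (\<Sum>i\<in>F. (cmod (coord x i))\<^sup>2) > (norm x)\<^sup>2 - e\<^sup>2"
    by (rule order_tendstoD) (use assms in simp)
  then obtain F where F: "finite F" "(\<Sum>i\<in>F. (cmod (coord x i))\<^sup>2) > (norm x)\<^sup>2 - e\<^sup>2"
    by (auto simp: eventually_finite_subsets_at_top)
  have l2: "(\<lambda>i. if i \<in> F then coord x i else 0) \<in> l2"
    unfolding l2_def mem_Collect_eq summable_on_def
    by (rule exI, rule has_sum_finite_neutralI[OF F(1), of _ _ "\<Sum>i\<in>F. (cmod (coord x i))\<^sup>2"]) auto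
  define y where "y = of_seq (\<lambda>i. if i \<in> F then coord x i else 0)"
  have y: "coord y i = (if i \<in> F then coord x i else 0)" for i by (simp add: y_def l2)
  have "((\<lambda>i. if i \<in> F then (cmod (coord x i))\<^sup>2 else 0) has_sum (\<Sum>i\<in>F. (cmod (coord x i))\<^sup>2)) UNIV"
    by (rule has_sum_finite_neutralI[OF F(1)]) auto
  from has_sum_add[OF norm2_ell2_has_sum[of x] has_sum_cmult_right[OF this, of "-1"]]
  have "((\<lambda>i. (cmod (coord (x - y) i))\<^sup>2) has_sum ((norm x)\<^sup>2 + - 1 * (\<Sum>i\<in>F. (cmod (coord x i))\<^sup>2))) UNIV"
    by (rule has_sum_cong[THEN iffD1, rotated]) (simp add: y)
  from has_sum_unique[OF norm2_ell2_has_sum[of "x - y"] this] F(2)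
  have "(norm (x - y))\<^sup>2 < e\<^sup>2" by simp
  then have "norm (x - y) < e" using assms by (simp add: power2_less_imp_less)
  moreover have "y \<in> finite_support" using F(1) unfolding finite_support_def
    by (auto simp: y elim: finite_subset[rotated])
  ultimately show ?thesis by blast
qed

lemma inner_eq_0_if_disjoint_support:
  assumes "\<And>i. coord x i = 0 \<or> coord y i = 0"
  shows "inner x y = 0"
proof -
  have "inner (coord x i) (coord y i) = 0" for i using assms[of i] by auto
  then show ?thesis by (simp add: inner_ell2_def)
qed

lemma coord_sum: "coord (\<Sum>k\<in>A. x k) i = (\<Sum>k\<in>A. coord (x k) i)"
  by (induction A rule: infinite_finite_induct) auto

definition unit_vector :: "int \<Rightarrow> ell2" where
  "unit_vector k = of_seq (\<lambda>i. if i = k then 1 else 0)"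

lemma coord_restriction: "coord (of_seq (\<lambda>i. if P i then coord x i else 0)) = (\<lambda>i. if P i then coord x i else 0)"
proof (rule coord_of_seq)
  have "(\<lambda>i. (cmod (if P i then coord x i else 0))\<^sup>2) summable_on UNIV"
    by (rule summable_on_comparison_test[OF has_sum_imp_summable[OF norm2_ell2_has_sum[of x]]]) auto
  then show "(\<lambda>i. if P i then coord x i else 0) \<in> l2" by (simp add: l2_def)
qed

lemma coord_unit_vector: "coord (unit_vector k) = (\<lambda>i. if i = k then 1 else 0)"
  unfolding unit_vector_def
proof (rule coord_of_seq)
  have "((\<lambda>i. (cmod (if i = k then 1 else 0))\<^sup>2) has_sum 1) UNIV"
    by (rule has_sum_finite_neutralI[of "{k}"]) auto
  then show "(\<lambda>i. if i = k then 1 else 0) \<in> l2" by (auto simp: l2_def summable_on_def)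
qed

lemma norm_unit_vector_pos: "norm (unit_vector k) > 0"
proof -
  have "coord (unit_vector k) k \<noteq> coord 0 k" by (simp add: coord_unit_vector)
  then have "unit_vector k \<noteq> 0" by metis
  then show ?thesis by simp
qed

lemma shift_diff: "shift k (x - y) = shift k x - shift k y"
  and shift_scaleR: "shift k (r *\<^sub>R x) = r *\<^sub>R shift k x"
  by (auto intro: ell2_eqI)

text \<open>A complex combination of \<open>B\<close> is a real combination of \<open>B\<close> and \<open>\<i> B\<close>, so finite codimension over
the complex numbers is finite codimension over the reals.\<close>

lemma cfun_span_real_span:
  assumes "h \<in> cfun.span B" "B \<subseteq> l2"
  shows "\<exists>s\<in>span (of_seq ` B \<union> mult_i ` of_seq ` B). h = coord s"
  using assms(1)
proof (induction rule: cfun.span_induct_alt)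
  case base
  show ?case by (intro bexI[of _ 0] span_zero) (simp add: zero_fun_def)
next
  case (step c x y)
  then obtain s where s: "s \<in> span (of_seq ` B \<union> mult_i ` of_seq ` B)" "y = coord s" by blast
  have x: "coord (of_seq x) = x" using step(1) assms(2) by auto
  show ?case
  proof (rule bexI)
    show "(\<lambda>i. c * x i) + y = coord (Re c *\<^sub>R of_seq x + Im c *\<^sub>R mult_i (of_seq x) + s)"
    proof
      fix i
      have "c * x i = Re c *\<^sub>R x i + Im c *\<^sub>R (\<i> * x i)"
        by (simp add: complex_eq_iff)
      then show "((\<lambda>i. c * x i) + y) i = coord (Re c *\<^sub>R of_seq x + Im c *\<^sub>R mult_i (of_seq x) + s) i"
        by (simp add: s(2) x)
    qed
    show "Re c *\<^sub>R of_seq x + Im c *\<^sub>R mult_i (of_seq x) + s \<in> span (of_seq ` B \<union> mult_i ` of_seq ` B)"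
      using step(1) by (intro span_add span_scale s(1)) (auto intro: span_base)
  qed
qed

lemma closed_if_closedin_l2:
  assumes "closedin l2.mtopology (coord ` S)"
  shows "closed S"
proof (rule closed_sequential_limits[THEN iffD2], intro allI impI)
  fix X l assume X: "(\<forall>n. X n \<in> S) \<and> X \<longlonglongrightarrow> l"
  have "limitin l2.mtopology (\<lambda>n. coord (X n)) (coord l) sequentially"
    unfolding l2.limitin_metric_dist_null
    using X tendsto_dist_iff[of X l sequentially] by (simp add: coord dist_ell2_conv_l2_dist)
  then have "coord l \<in> coord ` S"
    by (rule limitin_closedin[OF _ assms]) (use X in auto)
  then show "l \<in> S" by (auto simp: coord_inject)
qed

section \<open>The Laurent operator as a bounded symmetric operator\<close>

locale laurent_matrix =
  fixes p :: nat and b a :: "nat \<Rightarrow> real"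
  assumes p: "p \<ge> 2" and summable_a: "summable (\<lambda>k. \<bar>a k\<bar>)"
begin

abbreviation entry :: "int \<Rightarrow> int \<Rightarrow> real" where "entry \<equiv> laurent_entry p b a"

definition L :: "ell2 \<Rightarrow> ell2" where "L x = of_seq (laurent_operator p b a (coord x))"

lemma coord_L: "coord (L x) = laurent_operator p b a (coord x)"
  unfolding L_def by (rule coord_of_seq, rule laurent_operator_bounded[OF p summable_a, of b]) (simp add: coord)

lemma coord_L_has_sum: "((\<lambda>n. of_real (entry m n) * coord x n) has_sum coord (L x) m) UNIV"
proof -
  have "(\<lambda>n. cmod (of_real (entry m n) * coord x n)) summable_on UNIV"
    by (rule laurent_operator_bounded[OF p summable_a, of b]) (simp add: coord)
  from has_sum_infsum[OF abs_summable_summable[OF this]]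
  show ?thesis by (simp add: coord_L laurent_operator_def)
qed

lemma bounded_linear_L: "bounded_linear L"
proof -
  obtain C where C: "\<And>f. f \<in> l2 \<Longrightarrow> l2_norm (laurent_operator p b a f) \<le> C * l2_norm f"
    by (rule laurent_operator_bounded[OF p summable_a, of b]) blast
  show ?thesis
  proof (rule bounded_linear_intro)
    fix x y :: ell2 and r :: real
    have "((\<lambda>n. of_real (entry m n) * coord (x + y) n) has_sum coord (L x) m + coord (L y) m) UNIV" for m
      using has_sum_add[OF coord_L_has_sum[of m x] coord_L_has_sum[of m y]] by (simp add: ring_distribs)
    then have "coord (L (x + y)) m = coord (L x) m + coord (L y) m" for m
      by (rule has_sum_unique[OF coord_L_has_sum])
    then show "L (x + y) = L x + L y" by (intro ell2_eqI) simp
    have "((\<lambda>n. of_real (entry m n) * coord (r *\<^sub>R x) n) has_sum of_real r * coord (L x) m) UNIV" for m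
      using has_sum_cmult_right[OF coord_L_has_sum[of m x], of "of_real r"]
      by (simp add: scaleR_conv_of_real mult_ac)
    then have "coord (L (r *\<^sub>R x)) m = of_real r * coord (L x) m" for m
      by (rule has_sum_unique[OF coord_L_has_sum])
    then show "L (r *\<^sub>R x) = r *\<^sub>R L x" by (intro ell2_eqI) (simp add: scaleR_conv_of_real)
    show "norm (L x) \<le> norm x * C"
      using C[OF coord[of x]] by (simp add: norm_ell2_conv_l2_norm coord_L mult.commute)
  qed
qed

lemma L_mult_i: "L (mult_i x) = mult_i (L x)"
proof (rule ell2_eqI)
  fix m
  have "((\<lambda>n. of_real (entry m n) * coord (mult_i x) n) has_sum \<i> * coord (L x) m) UNIV"
    using has_sum_cmult_right[OF coord_L_has_sum[of m x], of "\<i>"] by (simp add: mult_ac)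
  then show "coord (L (mult_i x)) m = coord (mult_i (L x)) m"
    using has_sum_unique[OF coord_L_has_sum] by simp
qed

lemma entry_translate: "entry (m + int p * k) (n + int p * k) = entry m n"
  using p by (simp add: laurent_entry_def)

lemma L_shift: "L (shift (int p * k) x) = shift (int p * k) (L x)"
proof (rule ell2_eqI)
  fix m
  have "((\<lambda>n. of_real (entry (m - int p * k) (n - int p * k)) * coord x (n - int p * k))
      has_sum coord (L x) (m - int p * k)) UNIV"
    by (rule has_sum_translation(2)[THEN iffD2, OF coord_L_has_sum])
  then have "((\<lambda>n. of_real (entry m n) * coord (shift (int p * k) x) n)
      has_sum coord (L x) (m - int p * k)) UNIV"
    using entry_translate[of m "-k"] by simp
  then show "coord (L (shift (int p * k) x)) m = coord (shift (int p * k) (L x)) m"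
    using has_sum_unique[OF coord_L_has_sum] by simp
qed

text \<open>By the uniform bound on absolute row sums. Together with its mirror image this dominates the double
series of \<open>\<langle>L x, y\<rangle>\<close> and justifies exchanging the order of summation in \<open>inner_L\<close>.\<close>

lemma summable_entry_weighted: "(\<lambda>(m, n). \<bar>entry m n\<bar> * (cmod (coord y m))\<^sup>2) summable_on UNIV \<times> UNIV"
proof -
  obtain C where C: "\<And>m F. finite F \<Longrightarrow> (\<Sum>n\<in>F. \<bar>entry m n\<bar>) \<le> C"
    using laurent_entry_row_sum[OF p summable_a] by blast
  have "C \<ge> 0" using C[of "{}"] by simp
  show ?thesis
  proof (rule nonneg_bdd_above_summable_on)
    show "bdd_above (sum (\<lambda>(m, n). \<bar>entry m n\<bar> * (cmod (coord y m))\<^sup>2) ` {F. F \<subseteq> UNIV \<times> UNIV \<and> finite F})"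
    proof (rule bdd_aboveI2)
      fix F :: "(int \<times> int) set" assume "F \<in> {F. F \<subseteq> UNIV \<times> UNIV \<and> finite F}"
      then have F: "finite F" by simp
      have sub: "F \<subseteq> fst ` F \<times> snd ` F" by force
      have "(\<Sum>(m, n)\<in>F. \<bar>entry m n\<bar> * (cmod (coord y m))\<^sup>2)
          \<le> (\<Sum>(m, n)\<in>fst ` F \<times> snd ` F. \<bar>entry m n\<bar> * (cmod (coord y m))\<^sup>2)"
        by (rule sum_mono2) (use F sub in auto)
      also have "\<dots> = (\<Sum>m\<in>fst ` F. (\<Sum>n\<in>snd ` F. \<bar>entry m n\<bar>) * (cmod (coord y m))\<^sup>2)"
        by (simp add: sum.cartesian_product[symmetric] sum_distrib_right)
      also have "\<dots> \<le> (\<Sum>m\<in>fst ` F. C * (cmod (coord y m))\<^sup>2)"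
        using F by (intro sum_mono mult_right_mono C) auto
      also have "\<dots> = C * (\<Sum>m\<in>fst ` F. (cmod (coord y m))\<^sup>2)" by (simp add: sum_distrib_left)
      also have "\<dots> \<le> C * (norm y)\<^sup>2"
        using \<open>C \<ge> 0\<close> F finite_sum_le_has_sum[OF norm2_ell2_has_sum[of y], of "fst ` F"]
        by (intro mult_left_mono) auto
      finally show "(\<Sum>(m, n)\<in>F. \<bar>entry m n\<bar> * (cmod (coord y m))\<^sup>2) \<le> C * (norm y)\<^sup>2" .
    qed
  qed auto
qed

lemma inner_L: "inner (L x) y = inner x (L y)"
proof -
  define f where "f m n = inner (of_real (entry m n) * coord x n) (coord y m)" for m n
  have "(\<lambda>z. (\<lambda>(n, m). \<bar>entry n m\<bar> * (cmod (coord x n))\<^sup>2) (prod.swap z)) summable_on UNIV"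
    using summable_entry_weighted[of x]
    by (subst summable_on_reindex_bij_betw[OF bij_swap]) (simp only: UNIV_Times_UNIV)
  moreover have "(\<lambda>(n, m). \<bar>entry n m\<bar> * (cmod (coord x n))\<^sup>2) (prod.swap z)
      = (\<lambda>(m, n). \<bar>entry m n\<bar> * (cmod (coord x n))\<^sup>2) z" for z
    using laurent_entry_sym[of p b a "snd z" "fst z"] by (simp add: case_prod_unfold)
  ultimately have sx: "(\<lambda>(m, n). \<bar>entry m n\<bar> * (cmod (coord x n))\<^sup>2) summable_on UNIV \<times> UNIV"
    by (simp only: UNIV_Times_UNIV)
  have "(\<lambda>z. norm (case_prod f z)) summable_on UNIV \<times> UNIV"
  proof (rule Infinite_Sum.abs_summable_on_comparison_test')
    show "(\<lambda>z. (\<lambda>(m, n). \<bar>entry m n\<bar> * (cmod (coord x n))\<^sup>2) z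
        + (\<lambda>(m, n). \<bar>entry m n\<bar> * (cmod (coord y m))\<^sup>2) z) summable_on UNIV \<times> UNIV"
      by (rule summable_on_add[OF sx summable_entry_weighted])
    fix z :: "int \<times> int"
    obtain m n where z: "z = (m, n)" by force
    have "norm (f m n) \<le> cmod (of_real (entry m n) * coord x n) * cmod (coord y m)"
      unfolding f_def using Cauchy_Schwarz_ineq2 by simp
    also have "\<dots> = \<bar>entry m n\<bar> * (cmod (coord x n) * cmod (coord y m))" by (simp add: norm_mult)
    also have "\<dots> \<le> \<bar>entry m n\<bar> * ((cmod (coord x n))\<^sup>2 + (cmod (coord y m))\<^sup>2)"
      using sum_squares_bound[of "cmod (coord x n)" "cmod (coord y m)"]
      by (intro mult_left_mono) (auto intro: order_trans[rotated] simp: mult.assoc)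
    finally show "norm (case_prod f z) \<le> (\<lambda>(m, n). \<bar>entry m n\<bar> * (cmod (coord x n))\<^sup>2) z
        + (\<lambda>(m, n). \<bar>entry m n\<bar> * (cmod (coord y m))\<^sup>2) z"
      by (simp add: z distrib_left)
  qed
  then have f: "case_prod f summable_on UNIV \<times> UNIV" by (rule abs_summable_summable)
  have "(\<Sum>\<^sub>\<infinity>n. f m n) = inner (coord (L x) m) (coord y m)" for m
    unfolding f_def
    by (rule infsumI) (rule has_sum_bounded_linear[OF bounded_linear_inner_left coord_L_has_sum])
  then have "inner (L x) y = (\<Sum>\<^sub>\<infinity>m. \<Sum>\<^sub>\<infinity>n. f m n)" by (simp add: inner_ell2_def)
  also have "\<dots> = (\<Sum>\<^sub>\<infinity>n. \<Sum>\<^sub>\<infinity>m. f m n)" using f by (intro infsum_swap_banach) simp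
  also have "(\<Sum>\<^sub>\<infinity>m. f m n) = inner (coord x n) (coord (L y) n)" for n
  proof (rule infsumI)
    have "f m n = inner (coord x n) (of_real (entry n m) * coord y m)" for m
      by (simp add: f_def laurent_entry_sym[of p b a n m] inner_complex_def algebra_simps)
    then show "((\<lambda>m. f m n) has_sum inner (coord x n) (coord (L y) n)) UNIV"
      by (simp add: has_sum_bounded_linear[OF bounded_linear_inner_right coord_L_has_sum])
  qed
  then have "(\<Sum>\<^sub>\<infinity>n. \<Sum>\<^sub>\<infinity>m. f m n) = inner x (L y)" by (simp add: inner_ell2_def)
  finally show ?thesis .
qed

lemma residue_Suc:
  "m mod int p \<noteq> int p - 1 \<Longrightarrow> (m + 1) div int p = m div int p"
  "m mod int p \<noteq> int p - 1 \<Longrightarrow> (m + 1) mod int p = m mod int p + 1"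
  "m mod int p = int p - 1 \<Longrightarrow> (m + 1) mod int p = 0"
proof -
  have r: "0 \<le> m mod int p" "m mod int p < int p" using p by simp_all
  have m: "m + 1 = int p * (m div int p) + (m mod int p + 1)"
    using mult_div_mod_eq[of "int p" m] by linarith
  show "m mod int p \<noteq> int p - 1 \<Longrightarrow> (m + 1) div int p = m div int p"
    using r by (intro int_div_pos_eq[OF m]) auto
  show "m mod int p \<noteq> int p - 1 \<Longrightarrow> (m + 1) mod int p = m mod int p + 1"
    using r by (intro int_mod_pos_eq[OF m]) auto
  assume a: "m mod int p = int p - 1"
  have "m + 1 = int p * (m div int p + 1) + 0" using m a by (simp add: distrib_left)
  then show "(m + 1) mod int p = 0" by (simp only: add_0_right mod_mult_self1_is_0)
qed

text \<open>Every entry involving \<open>a\<close>, and every nonzero entry that links two blocks, sits in a row and a column of which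
one is the first and the other the last of its block. Excluding the first position of all blocks
(\<open>s = 0\<close>) or the last one (\<open>s = p - 1\<close>) removes all of them.\<close>

lemma entry_off_corner:
  assumes s: "s = 0 \<or> s = int p - 1" and m: "m mod int p \<noteq> s" and n: "n mod int p \<noteq> s"
  shows "entry m n = (if n = m then b (nat (m mod int p) + 1) else if n = m + 1 \<or> n = m - 1 then 1 else 0)"
proof -
  define i j where "i = nat (m mod int p) + 1" and "j = nat (n mod int p) + 1"
  have "0 \<le> m mod int p" "m mod int p < int p" "0 \<le> n mod int p" "n mod int p < int p"
    using p by simp_all
  then have i: "m mod int p = int i - 1" "1 \<le> i" "i \<le> p" and j: "n mod int p = int j - 1" "1 \<le> j" "j \<le> p"
    unfolding i_def j_def by linarith+
  have corner: "\<not> (i = 1 \<and> j = p)" "\<not> (i = p \<and> j = 1)" using s m n i j by auto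
  have entry: "entry m n = block p b a (m div int p - n div int p) i j"
    by (simp add: laurent_entry_def i_def j_def)
  have split: "m = int p * (m div int p) + m mod int p" "n = int p * (n div int p) + n mod int p"
    by simp_all
  show ?thesis
  proof (cases "m div int p = n div int p")
    case True
    then have "n = int p * (m div int p) + n mod int p" by simp
    then have "n - m = n mod int p - m mod int p" using split(1) by linarith
    then have "n - m = int j - int i" using i j by simp
    then have *: "n = m \<longleftrightarrow> i = j" "n = m + 1 \<or> n = m - 1 \<longleftrightarrow> i = j + 1 \<or> j = i + 1" by linarith+
    have "block p b a 0 i j = (if i = j then b i else if i = j + 1 \<or> j = i + 1 then 1 else 0)"
      using corner by (auto simp: block_def)
    then show ?thesis using True by (simp only: entry * diff_self i_def[symmetric])
  next
    case False
    have "n \<noteq> m" using False by auto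
    moreover have "n \<noteq> m + 1"
    proof
      assume nm: "n = m + 1"
      show False
      proof (cases "m mod int p = int p - 1")
        case True
        then show False using residue_Suc(3)[OF True] m n s nm by simp
      next
        case ne: False
        then show False using residue_Suc(1)[OF ne] False nm by simp
      qed
    qed
    moreover have "n \<noteq> m - 1"
    proof
      assume "n = m - 1"
      then have mn: "m = n + 1" by simp
      show False
      proof (cases "n mod int p = int p - 1")
        case True
        then show False using residue_Suc(3)[OF True] m n s mn by simp
      next
        case ne: False
        then show False using residue_Suc(1)[OF ne] False mn by simp
      qed
    qed
    moreover have "block p b a k i j = 0" if "k \<noteq> 0" for k
    proof -
      have "(i = 1 \<and> j = p) = False" "(j = 1 \<and> i = p) = False" using corner by blast+
      then show ?thesis using that by (simp only: block_def if_False if_cancel)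
    qed
    moreover have "m div int p - n div int p \<noteq> 0" using False by simp
    ultimately show ?thesis by (simp only: entry if_False simp_thms)
  qed
qed

text \<open>On sequences that vanish at the first position of every block, or at the last one, \<open>L\<close> acts away from
these positions as the doubly infinite Jacobi matrix with diagonal \<open>b\<close>, repeated periodically, and
off-diagonal entries \<open>1\<close>. The entries of \<open>L\<close> across a block boundary differ from those of this matrix,
but if \<open>m - 1\<close> or \<open>m + 1\<close> belongs to another block than \<open>m\<close>, then \<open>x\<close> vanishes there.\<close>

lemma coord_L_off_corner:
  assumes s: "s = 0 \<or> s = int p - 1" and x: "\<And>n. n mod int p = s \<Longrightarrow> coord x n = 0"
    and m: "m mod int p \<noteq> s"
  shows "coord (L x) m = of_real (b (nat (m mod int p) + 1)) * coord x m + coord x (m - 1) + coord x (m + 1)"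
proof -
  have e: "of_real (entry m n) * coord x n
      = (if n = m then of_real (b (nat (m mod int p) + 1)) * coord x n
         else if n = m + 1 \<or> n = m - 1 then coord x n else 0)" for n
    using entry_off_corner[OF s m, of n] x[of n] by (cases "n mod int p = s") auto
  have "((\<lambda>n. of_real (entry m n) * coord x n) has_sum
      (\<Sum>n\<in>{m - 1, m, m + 1}. of_real (entry m n) * coord x n)) UNIV"
    by (rule has_sum_finite_neutralI[of "{m - 1, m, m + 1}"]) (auto simp: e)
  then have "coord (L x) m = (\<Sum>n\<in>{m - 1, m, m + 1}. of_real (entry m n) * coord x n)"
    by (rule has_sum_unique[OF coord_L_has_sum])
  then show ?thesis unfolding e by simp
qed

end

section \<open>The ground state of a Jacobi matrix\<close>

text \<open>The solution of the three-term recurrence \<open>c (i - 1) + c (i + 1) = (b (i + 1) - t) * c i\<close>. Up to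
the alternating sign, its values at \<open>1, \<dots>, n\<close> form an eigenvector for the eigenvalue \<open>t\<close> of the
Jacobi matrix with diagonal \<open>b 2, \<dots>, b (n + 1)\<close> as soon as the value at \<open>n + 1\<close> is \<open>0\<close>.\<close>

fun jacobi_solution :: "(nat \<Rightarrow> real) \<Rightarrow> real \<Rightarrow> nat \<Rightarrow> real" where
  "jacobi_solution b t 0 = 0"
| "jacobi_solution b t (Suc 0) = 1"
| "jacobi_solution b t (Suc (Suc i)) = (b (i + 2) - t) * jacobi_solution b t (Suc i) - jacobi_solution b t i"

lemma continuous_on_jacobi_solution: "continuous_on UNIV (\<lambda>t. jacobi_solution b t i)"
proof (induction i rule: induct_nat_012)
  case (ge2 n)
  then show ?case unfolding jacobi_solution.simps by (intro continuous_intros)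
qed simp_all

text \<open>Increase \<open>t\<close> from a value where the solution is positive up to the first \<open>t = \<nu>\<close> at which some
\<open>c i\<close> with \<open>1 \<le> i \<le> n + 1\<close> vanishes. There all these \<open>c i\<close> are still nonnegative. A zero at \<open>i \<le> n\<close>
would give \<open>c (i + 1) = - c (i - 1)\<close>, hence also \<open>c (i - 1) = 0\<close>, and so on down to \<open>c 1 = 1\<close>.
So the zero is at \<open>n + 1\<close>.\<close>

lemma jacobi_ground_state:
  assumes n: "n \<ge> 1"
  shows "\<exists>\<nu>. jacobi_solution b \<nu> (Suc n) = 0 \<and> (\<forall>i\<in>{1..n}. jacobi_solution b \<nu> i > 0)"
proof -
  let ?c = "jacobi_solution b"
  \<comment> \<open>For \<open>b i - t \<ge> 2\<close> the recurrence makes the solution nondecreasing.\<close>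
  define lo where "lo = Min (b ` {2..Suc n}) - 2"
  have lo: "lo + 2 \<le> b i" if "i \<in> {2..Suc n}" for i
    unfolding lo_def using that by (simp add: Min_le)
  have low: "?c lo i \<le> ?c lo (Suc i) \<and> 1 \<le> ?c lo (Suc i)" if "i \<le> n" for i
    using that
  proof (induction i)
    case (Suc i)
    then have "?c lo i \<le> ?c lo (Suc i)" "1 \<le> ?c lo (Suc i)" by auto
    moreover have "2 * ?c lo (Suc i) \<le> (b (i + 2) - lo) * ?c lo (Suc i)"
      using lo[of "i + 2"] Suc.prems \<open>1 \<le> ?c lo (Suc i)\<close> by (intro mult_right_mono) auto
    ultimately show ?case unfolding jacobi_solution.simps by linarith
  qed simp
  define S where "S = {t. lo \<le> t \<and> (\<exists>i\<in>{1..Suc n}. ?c t i \<le> 0)}"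
  have "S = {lo..} \<inter> (\<Union>i\<in>{1..Suc n}. {t. ?c t i \<le> 0})" by (auto simp: S_def)
  moreover have "closed {t. ?c t i \<le> 0}" for i
    by (intro closed_Collect_le continuous_on_jacobi_solution continuous_on_const)
  ultimately have "closed S" by auto
  moreover have "b 2 \<in> S"
    using lo[of 2] n by (auto simp: S_def numeral_2_eq_2 intro!: bexI[of _ "Suc (Suc 0)"])
  moreover have bdd: "bdd_below S" by (auto simp: S_def bdd_below_def)
  ultimately have inS: "Inf S \<in> S" by (intro closed_contains_Inf) auto
  define \<nu> where "\<nu> = Inf S"
  have \<nu>: "lo \<le> \<nu>" "\<exists>i\<in>{1..Suc n}. ?c \<nu> i \<le> 0" using inS by (auto simp: S_def \<nu>_def)
  have "lo \<notin> S"
  proof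
    assume "lo \<in> S"
    then obtain i where "i \<in> {1..Suc n}" "?c lo i \<le> 0" by (auto simp: S_def)
    then show False using low[of "i - 1"] by (cases i) auto
  qed
  then have "lo < \<nu>" using \<nu>(1) inS by (metis \<nu>_def le_less)
  have before: "?c t i > 0" if "lo \<le> t" "t < \<nu>" "i \<in> {1..Suc n}" for t i
    using that cInf_lower[OF _ bdd, of t] unfolding \<nu>_def S_def by (smt (verit) mem_Collect_eq)
  have nonneg: "?c \<nu> i \<ge> 0" if i: "i \<in> {1..Suc n}" for i
  proof (rule tendsto_lowerbound)
    show "((\<lambda>t. ?c t i) \<longlongrightarrow> ?c \<nu> i) (at_left \<nu>)"
      using continuous_on_jacobi_solution[of b i] by (auto simp: continuous_on_def intro: tendsto_within_subset)
    show "\<forall>\<^sub>F t in at_left \<nu>. 0 \<le> ?c t i"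
      using eventually_at_left_real[OF \<open>lo < \<nu>\<close>]
      by eventually_elim (auto intro!: less_imp_le before i)
  qed simp
  have pos: "?c \<nu> (Suc i) > 0" if "Suc i \<le> n" for i
    using that
  proof (induction i)
    case (Suc i)
    have "?c \<nu> (Suc (Suc i)) \<noteq> 0"
    proof
      assume "?c \<nu> (Suc (Suc i)) = 0"
      then have "?c \<nu> (Suc (Suc (Suc i))) = - ?c \<nu> (Suc i)"
        by (subst jacobi_solution.simps(3)) (simp only: mult_zero_right diff_0)
      then show False using Suc nonneg[of "Suc (Suc (Suc i))"] by auto
    qed
    then show ?case using nonneg[of "Suc (Suc i)"] Suc.prems by auto
  qed simp
  obtain i where i: "i \<in> {1..Suc n}" "?c \<nu> i \<le> 0" using \<nu>(2) by blast
  have "i = Suc n"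
  proof (rule ccontr)
    assume "i \<noteq> Suc n"
    moreover obtain j where "i = Suc j" using i(1) by (cases i) auto
    ultimately show False using pos[of j] i by auto
  qed
  then have "?c \<nu> (Suc n) = 0" using i nonneg[of "Suc n"] by auto
  moreover have "?c \<nu> i > 0" if "i \<in> {1..n}" for i using pos[of "i - 1"] that by (cases i) auto
  ultimately show ?thesis by blast
qed

section \<open>The gap in the quadratic form\<close>

context laurent_matrix
begin

text \<open>The position inside its block, counted from \<open>0\<close>: the index \<open>m\<close> carries the diagonal entry
\<open>b (res m + 1)\<close>.\<close>

definition res :: "int \<Rightarrow> nat" where "res m = nat (m mod int p)"

lemma res_less: "res m < p" and int_res: "int (res m) = m mod int p"
  using p by (simp_all add: res_def nat_less_iff)

lemma res_Suc: "res m + 1 < p \<Longrightarrow> res (m + 1) = res m + 1" "res m = p - 1 \<Longrightarrow> res (m + 1) = 0"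
  using residue_Suc(2,3)[of m] int_res[of m] int_res[of "m + 1"] p by (auto simp: of_nat_diff)

lemma res_pred: "res m > 0 \<Longrightarrow> res (m - 1) = res m - 1" "res m = 0 \<Longrightarrow> res (m - 1) = p - 1"
  using res_Suc[of "m - 1"] res_less[of "m - 1"] p by fastforce+

lemma summable_residue_weight: "(\<lambda>m. g (res m) * (cmod (coord x m))\<^sup>2) summable_on UNIV"
proof (rule abs_summable_summable, rule Infinite_Sum.abs_summable_on_comparison_test')
  show "(\<lambda>m. (\<Sum>r<p. \<bar>g r\<bar>) * (cmod (coord x m))\<^sup>2) summable_on UNIV"
    by (rule summable_on_cmult_right[OF has_sum_imp_summable[OF norm2_ell2_has_sum]])
  fix m
  have "\<bar>g (res m)\<bar> \<le> (\<Sum>r<p. \<bar>g r\<bar>)" using res_less by (intro member_le_sum) auto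
  then show "norm (g (res m) * (cmod (coord x m))\<^sup>2) \<le> (\<Sum>r<p. \<bar>g r\<bar>) * (cmod (coord x m))\<^sup>2"
    by (simp add: abs_mult mult_right_mono)
qed

text \<open>The inequality \<open>\<langle>N x, x\<rangle> \<ge> \<nu> \<parallel>x\<parallel>\<^sup>2\<close> for a Jacobi matrix \<open>N\<close> with positive ground state \<open>c\<close>, applied in
each block to positions \<open>1, \<dots>, p - 1\<close>. By the inequality of arithmetic and geometric means the
coupling of the positions \<open>r\<close> and \<open>r + 1\<close> is at least
\<open>- (c (r + 1) / c r) \<bar>w r\<bar>\<^sup>2 - (c r / c (r + 1)) \<bar>w (r + 1)\<bar>\<^sup>2\<close>; collecting the two contributions at
one position gives exactly \<open>- (b (r + 1) - \<nu>) \<bar>w r\<bar>\<^sup>2\<close> by the recurrence. With \<open>c 0 = c p = 0\<close> and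
\<open>x / 0 = 0\<close> the formulas hold at block boundaries too.\<close>

lemma form_lower_bound:
  assumes w: "\<And>m. res m = 0 \<Longrightarrow> coord w m = 0"
    and c0: "c 0 = 0" and cp: "c p = 0" and cpos: "\<And>i. 1 \<le> i \<Longrightarrow> i < p \<Longrightarrow> c i > 0"
    and rec: "\<And>i. 1 \<le> i \<Longrightarrow> i < p \<Longrightarrow> (b (i + 1) - \<nu>) * c i = c (i - 1) + c (i + 1)"
  shows "\<nu> * (norm w)\<^sup>2 \<le> inner (L w) w"
proof -
  define n where "n m = (cmod (coord w m))\<^sup>2" for m
  define G where "G m = c (res m + 1) / c (res m) * n m" for m
  define H where "H m = c (res m - 1) / c (res m) * n m" for m
  have cnn: "c i \<ge> 0" if "i \<le> p" for i
    using that c0 cp cpos[of i] by (cases "i = 0"; cases "i = p") auto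
  have nn: "0 \<le> G m" "0 \<le> H m" for m
    unfolding G_def H_def n_def using res_less[of m] by (auto intro!: mult_nonneg_nonneg divide_nonneg_nonneg cnn)
  have amgm: "- (G m + H (m + 1)) \<le> 2 * inner (coord w m) (coord w (m + 1))" for m
  proof (cases "res m = 0 \<or> res m = p - 1")
    case True
    then have "coord w m = 0 \<or> coord w (m + 1) = 0" using w res_Suc(2) by auto
    then show ?thesis using nn[of m] nn[of "m + 1"] by (auto simp: inner_commute)
  next
    case False
    then have r: "1 \<le> res m" "res m + 1 < p" using res_less[of m] by auto
    define q where "q = c (res m + 1) / c (res m)"
    have q: "q > 0" using r cpos by (simp add: q_def)
    have G: "G m = q * n m" and H: "H (m + 1) = n (m + 1) / q"
      using r by (simp_all add: G_def H_def q_def res_Suc(1))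
    have "0 \<le> q * (norm (coord w m + (1 / q) *\<^sub>R coord w (m + 1)))\<^sup>2" using q by simp
    also have "\<dots> = q * n m + 2 * inner (coord w m) (coord w (m + 1)) + n (m + 1) / q"
      using q unfolding n_def power2_norm_eq_inner
      by (simp add: inner_left_distrib inner_right_distrib inner_commute field_simps power2_eq_square)
    finally show ?thesis by (simp add: G H)
  qed
  have point: "\<nu> * n m + 1/2 * G m + - 1/2 * G (m - 1) + 1/2 * H m + - 1/2 * H (m + 1)
      \<le> inner (coord (L w) m) (coord w m)" for m
  proof (cases "res m = 0")
    case True
    then have "coord w m = 0" by (rule w)
    then show ?thesis using nn[of "m - 1"] nn[of "m + 1"] by (simp add: G_def H_def n_def)
  next
    case False
    have s: "n mod int p = 0 \<Longrightarrow> coord w n = 0" for n using w by (simp add: res_def)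
    have m: "m mod int p \<noteq> 0" using False int_res[of m] by simp
    have r: "1 \<le> res m" "res m < p" using False res_less by auto
    have "inner (coord (L w) m) (coord w m)
        = b (res m + 1) * n m + inner (coord w (m - 1)) (coord w m) + inner (coord w m) (coord w (m + 1))"
      by (subst coord_L_off_corner[OF disjI1[OF refl] s m])
        (simp_all add: inner_add_left inner_add_right n_def power2_norm_eq_inner inner_commute res_def
          scaleR_conv_of_real[symmetric])
    moreover have "(b (res m + 1) - \<nu>) * n m = G m + H m"
      using rec[OF r] cpos[OF r] by (simp add: G_def H_def field_simps)
    ultimately show ?thesis using amgm[of m] amgm[of "m - 1"] by (simp add: algebra_simps)
  qed
  have nsum: "(n has_sum (norm w)\<^sup>2) UNIV" unfolding n_def by (rule norm2_ell2_has_sum)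
  obtain sG where sG: "(G has_sum sG) UNIV"
    using summable_residue_weight[of "\<lambda>r. c (r + 1) / c r" w] unfolding G_def n_def summable_on_def by blast
  obtain sH where sH: "(H has_sum sH) UNIV"
    using summable_residue_weight[of "\<lambda>r. c (r - 1) / c r" w] unfolding H_def n_def summable_on_def by blast
  \<comment> \<open>The translated copies of \<open>G\<close> and \<open>H\<close> cancel after summation over all indices.\<close>
  have "((\<lambda>m. \<nu> * n m + 1/2 * G m + - 1/2 * G (m - 1) + 1/2 * H m + - 1/2 * H (m + 1))
      has_sum (\<nu> * (norm w)\<^sup>2 + 1/2 * sG + - 1/2 * sG + 1/2 * sH + - 1/2 * sH)) UNIV"
    by (intro has_sum_add has_sum_cmult_right nsum sG sH has_sum_translation[THEN iffD2])
  from has_sum_mono[OF this inner_ell2_has_sum point] show ?thesis by simp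
qed

text \<open>For \<open>y\<close> supported on the first positions of the blocks, this places in each block the multiple by
the entry of \<open>y\<close> of the vector with entries \<open>(- 1) ^ r * c (r + 1)\<close>. A sum of translates makes the
norm bound immediate.\<close>

definition alternating_extension :: "(nat \<Rightarrow> real) \<Rightarrow> ell2 \<Rightarrow> ell2" where
  "alternating_extension c y = (\<Sum>r<p. ((- 1) ^ r * c (r + 1)) *\<^sub>R shift (int r) y)"

lemma coord_alternating_extension:
  assumes y: "\<And>m. res m \<noteq> 0 \<Longrightarrow> coord y m = 0"
  shows "coord (alternating_extension c y) m
    = of_real ((- 1) ^ res m * c (res m + 1)) * coord y (m - int (res m))"
proof -
  have z: "coord y (m - int r) = 0" if "r < p" "r \<noteq> res m" for r
  proof (rule y)
    have "m - int r = int p * (m div int p) + (int (res m) - int r)"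
      unfolding int_res using mult_div_mod_eq[of "int p" m] by linarith
    then have "(m - int r) mod int p = (int (res m) - int r) mod int p" by (metis mod_mult_self4)
    moreover have "(int (res m) - int r) mod int p \<noteq> 0"
      using that res_less[of m] zdvd_not_zless[of "\<bar>int (res m) - int r\<bar>" "int p"]
      by (auto simp: mod_eq_0_iff_dvd)
    ultimately show "res (m - int r) \<noteq> 0" using int_res[of "m - int r"] by auto
  qed
  have "coord (alternating_extension c y) m
      = (\<Sum>r<p. of_real ((- 1) ^ r * c (r + 1)) * coord y (m - int r))"
    unfolding alternating_extension_def coord_sum by (simp add: scaleR_conv_of_real)
  also have "\<dots> = (\<Sum>r\<in>{res m}. of_real ((- 1) ^ r * c (r + 1)) * coord y (m - int r))"
    by (rule sum.mono_neutral_right) (use res_less z in auto)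
  finally show ?thesis by simp
qed

lemma norm_alternating_extension_le: "norm (alternating_extension c y) \<le> (\<Sum>r<p. \<bar>c (r + 1)\<bar>) * norm y"
proof -
  have "norm (alternating_extension c y) \<le> (\<Sum>r<p. norm (((- 1) ^ r * c (r + 1)) *\<^sub>R shift (int r) y))"
    unfolding alternating_extension_def by (rule norm_sum)
  also have "\<dots> = (\<Sum>r<p. \<bar>c (r + 1)\<bar>) * norm y" by (simp add: abs_mult power_abs sum_distrib_right)
  finally show ?thesis .
qed

text \<open>In position \<open>r\<close> of a block, the vector with entries \<open>(- 1) ^ r * c (r + 1)\<close> satisfies the eigenvalue
equation for \<open>\<nu>\<close> with \<open>b (r + 2)\<close> on the diagonal, whereas \<open>L\<close> has \<open>b (r + 1)\<close> there. Hence
\<open>L u = (\<nu> - D) u\<close> with \<open>D r = b (r + 2) - b (r + 1)\<close>, except at the last positions, where \<open>u\<close> vanishes.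
The form thus falls short of \<open>\<nu> \<parallel>u\<parallel>\<^sup>2\<close> at least by the contribution of the position \<open>k - 1\<close>, and there
\<open>\<bar>u\<bar> = c k * \<bar>y\<bar>\<close>.\<close>

lemma form_upper_bound:
  assumes y: "\<And>m. res m \<noteq> 0 \<Longrightarrow> coord y m = 0"
    and c0: "c 0 = 0" and cp: "c p = 0"
    and rec: "\<And>i. 1 \<le> i \<Longrightarrow> i < p \<Longrightarrow> (b (i + 1) - \<nu>) * c i = c (i - 1) + c (i + 1)"
    and mono: "\<And>i. 1 \<le> i \<Longrightarrow> i < p \<Longrightarrow> b i \<le> b (i + 1)" and k: "1 \<le> k" "k < p"
  defines "u \<equiv> alternating_extension c y"
  shows "inner (L u) u + (b (k + 1) - b k) * (c k)\<^sup>2 * (norm y)\<^sup>2 \<le> \<nu> * (norm u)\<^sup>2"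
proof -
  define D where "D r = (if r + 1 < p then b (r + 2) - b (r + 1) else 0)" for r
  define n where "n m = (cmod (coord u m))\<^sup>2" for m
  note cu = coord_alternating_extension[OF y, where c = c, folded u_def]
  have u_last: "coord u m = 0" if "res m = p - 1" for m
  proof -
    have "res m + 1 = p" using that p by simp
    then show ?thesis by (simp add: cu cp)
  qed
  have D: "D r \<ge> 0" for r using mono[of "r + 1"] by (simp add: D_def)
  have Lu: "inner (coord (L u) m) (coord u m) = \<nu> * n m + - 1 * (D (res m) * n m)" for m
  proof (cases "res m = p - 1")
    case True
    then show ?thesis by (simp add: u_last n_def)
  next
    case False
    define r where "r = res m"
    have r: "r + 1 < p" using False res_less[of m] by (simp add: r_def)
    define e where "e = (- 1) ^ r * coord y (m - int r)"
    have s: "n mod int p = int p - 1 \<Longrightarrow> coord u n = 0" for n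
      using u_last[of n] p by (simp add: res_def nat_diff_distrib)
    have m: "m mod int p \<noteq> int p - 1" using False int_res[of m] p by auto
    have u0: "coord u m = of_real (c (r + 1)) * e" by (simp add: cu e_def r_def)
    have u1: "coord u (m + 1) = - of_real (c (r + 2)) * e"
      using res_Suc(1)[of m] r by (simp add: cu e_def r_def)
    have u2: "coord u (m - 1) = - of_real (c r) * e"
    proof (cases r)
      case 0
      then show ?thesis using res_pred(2)[of m] by (simp add: r_def c0 u_last)
    next
      case (Suc r')
      then have "res (m - 1) = r'" using res_pred(1)[of m] by (simp add: r_def)
      then show ?thesis using Suc by (simp add: cu e_def algebra_simps)
    qed
    have "coord (L u) m = of_real (b (r + 1)) * coord u m + coord u (m - 1) + coord u (m + 1)"
      using coord_L_off_corner[OF disjI2[OF refl] s m] by (simp add: r_def res_def)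
    also have "\<dots> = of_real (b (r + 1) * c (r + 1) - (c r + c (r + 2))) * e"
      unfolding u0 u1 u2 by (simp add: algebra_simps)
    also have "b (r + 1) * c (r + 1) - (c r + c (r + 2)) = (\<nu> - D r) * c (r + 1)"
      using rec[of "r + 1"] r by (simp add: D_def algebra_simps)
    also have "of_real ((\<nu> - D r) * c (r + 1)) * e = (\<nu> - D r) *\<^sub>R coord u m"
      unfolding u0 by (simp add: scaleR_conv_of_real)
    finally have "coord (L u) m = (\<nu> - D r) *\<^sub>R coord u m" .
    then show ?thesis by (simp add: n_def power2_norm_eq_inner r_def left_diff_distrib)
  qed
  obtain sD where sD: "((\<lambda>m. D (res m) * n m) has_sum sD) UNIV"
    using summable_residue_weight[of D u] unfolding n_def summable_on_def by blast
  have nsum: "(n has_sum (norm u)\<^sup>2) UNIV" unfolding n_def by (rule norm2_ell2_has_sum)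
  have "((\<lambda>m. \<nu> * n m + - 1 * (D (res m) * n m)) has_sum (\<nu> * (norm u)\<^sup>2 + - 1 * sD)) UNIV"
    by (intro has_sum_add has_sum_cmult_right nsum sD)
  then have eq: "inner (L u) u = \<nu> * (norm u)\<^sup>2 - sD"
    using has_sum_unique[OF inner_ell2_has_sum[of "L u" u]] by (simp add: Lu)
  have "((\<lambda>m. (b (k + 1) - b k) * (c k)\<^sup>2 * (cmod (coord y (m - int (k - 1))))\<^sup>2)
      has_sum (b (k + 1) - b k) * (c k)\<^sup>2 * (norm y)\<^sup>2) UNIV"
    by (intro has_sum_cmult_right
        has_sum_translation(2)[of "\<lambda>m. (cmod (coord y m))\<^sup>2", THEN iffD2] norm2_ell2_has_sum)
  then have "(b (k + 1) - b k) * (c k)\<^sup>2 * (norm y)\<^sup>2 \<le> sD"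
  proof (rule has_sum_mono[OF _ sD])
    fix m
    show "(b (k + 1) - b k) * (c k)\<^sup>2 * (cmod (coord y (m - int (k - 1))))\<^sup>2 \<le> D (res m) * n m"
    proof (cases "coord y (m - int (k - 1)) = 0")
      case True
      then show ?thesis using D by (simp add: n_def)
    next
      case False
      then have "res (m - int (k - 1)) = 0" using y by blast
      then have "(m - int (k - 1)) mod int p = 0" using int_res[of "m - int (k - 1)"] by simp
      then have "m mod int p = int (k - 1) mod int p" by (simp add: mod_eq_dvd_iff mod_eq_0_iff_dvd)
      then have r: "res m = k - 1" using k by (simp add: res_def)
      then show ?thesis using k by (simp add: n_def cu D_def norm_mult norm_power power_mult_distrib)
    qed
  qed
  then show ?thesis using eq by simp
qed

text \<open>The number \<open>l = \<nu> - \<delta>\<close> lies so little below \<open>\<nu>\<close> that the form of \<open>L - l\<close> is still at most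
\<open>- \<delta> \<parallel>u\<parallel>\<^sup>2\<close> on alternating extensions of sequences supported on the first positions, while it is at least \<open>\<delta> \<parallel>w\<parallel>\<^sup>2\<close> on sequences
vanishing at all first positions. Subtracting from \<open>x\<close> the extension \<open>u\<close> of its first entries leaves
such a \<open>w\<close>, since \<open>c 1 = 1\<close>.\<close>

lemma form_gap:
  assumes mono: "\<And>i. 1 \<le> i \<Longrightarrow> i < p \<Longrightarrow> b i \<le> b (i + 1)" and k: "1 \<le> k" "k < p" "b k < b (k + 1)"
  shows "\<exists>l d. d > 0 \<and> (\<forall>x. d * norm x \<le> norm (L x - l *\<^sub>R x)) \<and>
    (\<exists>x. inner (L x) x < l * (norm x)\<^sup>2) \<and> (\<exists>x. inner (L x) x > l * (norm x)\<^sup>2)"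
proof -
  interpret L: bounded_linear L by (rule bounded_linear_L)
  obtain \<nu> where \<nu>: "jacobi_solution b \<nu> (Suc (p - 1)) = 0" "\<forall>i\<in>{1..p - 1}. jacobi_solution b \<nu> i > 0"
    using jacobi_ground_state[of "p - 1" b] p by fastforce
  define c where "c = jacobi_solution b \<nu>"
  have c0: "c 0 = 0" and c1: "c 1 = 1" and cp: "c p = 0"
    and cpos: "\<And>i. 1 \<le> i \<Longrightarrow> i < p \<Longrightarrow> c i > 0"
    using \<nu> p by (auto simp: c_def)
  have rec: "(b (i + 1) - \<nu>) * c i = c (i - 1) + c (i + 1)" if "1 \<le> i" for i
    using that by (cases i) (simp_all add: c_def)
  define K where "K = (\<Sum>r<p. \<bar>c (r + 1)\<bar>)"
  define \<kappa> where "\<kappa> = (b (k + 1) - b k) * (c k)\<^sup>2"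
  \<comment> \<open>By \<open>\<parallel>u\<parallel> \<le> K \<parallel>y\<parallel>\<close>, raising the form by \<open>\<delta> \<parallel>u\<parallel>\<^sup>2\<close> uses up at most half of the defect \<open>\<kappa> \<parallel>y\<parallel>\<^sup>2\<close>.\<close>
  define \<delta> where "\<delta> = \<kappa> / (2 * K\<^sup>2)"
  define l where "l = \<nu> - \<delta>"
  have "\<bar>c (0 + 1)\<bar> \<le> K" unfolding K_def by (rule member_le_sum) (use p in auto)
  then have K: "K > 0" using c1 by simp
  have \<kappa>: "\<kappa> > 0" using k cpos[of k] by (simp add: \<kappa>_def)
  then have \<delta>: "\<delta> > 0" and \<delta>K: "\<delta> * K\<^sup>2 = \<kappa> / 2" using K by (simp_all add: \<delta>_def)
  have upper: "inner (L u) u \<le> l * (norm u)\<^sup>2 - \<kappa> / 2 * (norm y)\<^sup>2" "\<delta> * (norm u)\<^sup>2 \<le> \<kappa> / 2 * (norm y)\<^sup>2"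
    if "\<And>m. res m \<noteq> 0 \<Longrightarrow> coord y m = 0" and u: "u = alternating_extension c y" for u y
  proof -
    have "(norm u)\<^sup>2 \<le> (K * norm y)\<^sup>2"
      unfolding u K_def by (intro power_mono norm_alternating_extension_le) simp
    then have "\<delta> * (norm u)\<^sup>2 \<le> \<delta> * (K\<^sup>2 * (norm y)\<^sup>2)"
      using \<delta> by (simp add: power_mult_distrib)
    then show *: "\<delta> * (norm u)\<^sup>2 \<le> \<kappa> / 2 * (norm y)\<^sup>2" by (simp only: mult.assoc[symmetric] \<delta>K)
    have "inner (L u) u + \<kappa> * (norm y)\<^sup>2 \<le> \<nu> * (norm u)\<^sup>2"
      unfolding u \<kappa>_def by (rule form_upper_bound[OF that(1) c0 cp rec mono k(1,2)])
    then show "inner (L u) u \<le> l * (norm u)\<^sup>2 - \<kappa> / 2 * (norm y)\<^sup>2"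
      using * by (simp add: l_def left_diff_distrib)
  qed
  have lower: "\<nu> * (norm w)\<^sup>2 \<le> inner (L w) w" if "\<And>m. res m = 0 \<Longrightarrow> coord w m = 0" for w
    by (rule form_lower_bound[OF that c0 cp cpos rec])
  have "\<delta> / 2 * norm x \<le> norm (L x - l *\<^sub>R x)" for x
  proof -
    define A where "A x = L x - l *\<^sub>R x" for x
    have A_add: "A (x + y) = A x + A y" for x y by (simp add: A_def L.add algebra_simps)
    have A_sym: "inner (A x) y = inner x (A y)" for x y by (simp add: A_def inner_diff inner_L)
    define y where "y = of_seq (\<lambda>m. if res m = 0 then coord x m else 0)"
    have cy: "coord y m = (if res m = 0 then coord x m else 0)" for m
      by (simp add: y_def coord_restriction)
    define u where "u = alternating_extension c y"
    define w where "w = x - u"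
    have y0: "coord y m = 0" if "res m \<noteq> 0" for m using that by (simp add: cy)
    have "coord u m = coord x m" if "res m = 0" for m
      using coord_alternating_extension[OF y0, where c = c] that c1 by (simp add: u_def cy)
    then have "\<nu> * (norm w)\<^sup>2 \<le> inner (L w) w" by (intro lower) (simp add: w_def)
    then have Aw: "\<delta> * (norm w)\<^sup>2 \<le> inner (A w) w"
      by (simp add: A_def l_def inner_diff power2_norm_eq_inner algebra_simps)
    have Au: "inner (A u) u \<le> - \<delta> * (norm u)\<^sup>2"
      using upper[OF y0 u_def] by (simp add: A_def inner_diff power2_norm_eq_inner)
    define R where "R = (norm u)\<^sup>2 + (norm w)\<^sup>2"
    have x: "x = u + w" by (simp add: w_def)
    have par: "(norm (u + w))\<^sup>2 + (norm (w - u))\<^sup>2 = 2 * R"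
      by (simp add: R_def power2_norm_eq_inner algebra_simps inner_commute)
    have x2: "(norm x)\<^sup>2 \<le> 2 * R" and s2: "(norm (w - u))\<^sup>2 \<le> 2 * R"
      using par by (simp_all add: x) (smt (verit) zero_le_power2)+
    have "inner (A x) (w - u) = inner (A w) w - inner (A u) u"
      using A_sym[of u w] by (simp add: x A_add inner_diff_left inner_diff_right inner_add_left inner_add_right inner_commute)
    then have "\<delta> * R \<le> inner (A x) (w - u)" using Aw Au by (simp add: R_def distrib_left)
    also have "\<dots> \<le> norm (A x) * norm (w - u)" by (rule norm_cauchy_schwarz)
    finally have "(\<delta> * R)\<^sup>2 \<le> (norm (A x) * norm (w - u))\<^sup>2"
      using \<delta> by (intro power_mono) (auto simp: R_def)
    also have "\<dots> \<le> (norm (A x))\<^sup>2 * (2 * R)"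
      unfolding power_mult_distrib by (intro mult_left_mono s2) simp
    finally have "R * (\<delta>\<^sup>2 * R) \<le> R * (2 * (norm (A x))\<^sup>2)"
      by (simp add: power_mult_distrib power2_eq_square mult_ac)
    then have "\<delta>\<^sup>2 * R \<le> 2 * (norm (A x))\<^sup>2"
      using mult_le_cancel_left_pos[of R] by (cases "R = 0") (auto simp: R_def order_less_le)
    moreover have "\<delta>\<^sup>2 * (norm x)\<^sup>2 \<le> \<delta>\<^sup>2 * (2 * R)" using x2 by (intro mult_left_mono) auto
    ultimately have "(\<delta> / 2 * norm x)\<^sup>2 \<le> (norm (A x))\<^sup>2"
      by (simp add: power_mult_distrib power_divide)
    then show ?thesis unfolding A_def by (rule power2_le_imp_le) simp
  qed
  moreover have "\<exists>x. inner (L x) x < l * (norm x)\<^sup>2"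
  proof -
    define u where "u = alternating_extension c (unit_vector 0)"
    have "coord (unit_vector 0) m = 0" if "res m \<noteq> 0" for m
      using that by (auto simp: coord_unit_vector res_def)
    from upper(1)[OF this u_def]
    have "inner (L u) u \<le> l * (norm u)\<^sup>2 - \<kappa> / 2 * (norm (unit_vector 0))\<^sup>2" .
    moreover have "0 < \<kappa> / 2 * (norm (unit_vector 0))\<^sup>2"
      using \<kappa> norm_unit_vector_pos[of 0] by simp
    ultimately have "inner (L u) u < l * (norm u)\<^sup>2" by linarith
    then show ?thesis by blast
  qed
  moreover have "\<exists>x. inner (L x) x > l * (norm x)\<^sup>2"
  proof -
    have "coord (unit_vector 1) m = 0" if "res m = 0" for m
      using that p by (auto simp: coord_unit_vector res_def)
    from lower[OF this] have "\<nu> * (norm (unit_vector 1))\<^sup>2 \<le> inner (L (unit_vector 1)) (unit_vector 1)" .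
    moreover have "\<delta> * (norm (unit_vector 1))\<^sup>2 > 0" using \<delta> norm_unit_vector_pos[of 1] by simp
    ultimately show ?thesis
      by (intro exI[of _ "unit_vector 1"]) (simp add: l_def left_diff_distrib)
  qed
  ultimately show ?thesis using \<delta> by (intro exI[of _ l] exI[of _ "\<delta> / 2"]) auto
qed

section \<open>The essential spectrum on both sides of the gap\<close>

text \<open>For symmetric \<open>A = L - Re z\<close> commuting with multiplication by \<open>\<i>\<close>, the imaginary part only helps:
\<open>\<parallel>(A - \<i> s) x\<parallel>\<^sup>2 = \<parallel>A x\<parallel>\<^sup>2 + s\<^sup>2 \<parallel>x\<parallel>\<^sup>2\<close>. So \<open>L - z\<close> and its adjoint are both bounded below, and
\<open>L - z\<close> is bijective.\<close>

lemma not_in_essential_spectrum: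
  assumes d: "d > 0" and below: "\<And>x. d * norm x \<le> norm (L x - Re z *\<^sub>R x)"
  shows "z \<notin> essential_spectrum (laurent_operator p b a)"
proof -
  define A where "A x = L x - Re z *\<^sub>R x" for x
  \<comment> \<open>\<open>T 1\<close> is \<open>L - z\<close>, and \<open>T (- 1)\<close> is its adjoint.\<close>
  define T where "T s x = A x - (s * Im z) *\<^sub>R mult_i x" for s x
  have A_mult_i: "A (mult_i x) = mult_i (A x)" for x
    by (simp add: A_def L_mult_i linear_simps[OF bounded_linear_mult_i])
  have A_sym: "inner (A x) y = inner x (A y)" for x y by (simp add: A_def inner_diff inner_L)
  have "inner (A x) (mult_i x) = 0" for x
    using A_sym[of x "mult_i x"] inner_mult_i[of x "A x"] by (simp add: A_mult_i inner_commute)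
  then have "(norm (T s x))\<^sup>2 = (norm (A x))\<^sup>2 + (s * Im z)\<^sup>2 * (norm x)\<^sup>2" for s x
    using arg_cong[OF norm_mult_i[of x], of "\<lambda>r. r\<^sup>2"] unfolding T_def power2_norm_eq_inner
    by (simp add: inner_diff inner_commute power2_eq_square)
  then have "(norm (A x))\<^sup>2 \<le> (norm (T s x))\<^sup>2" for s x by simp
  then have "norm (A x) \<le> norm (T s x)" for s x by (rule power2_le_imp_le) simp
  then have T_below: "d * norm x \<le> norm (T s x)" for s x
    by (rule order_trans[OF below[of x, folded A_def]])
  have bl: "bounded_linear (T s)" for s unfolding T_def A_def
    by (intro bounded_linear_sub bounded_linear_L bounded_linear_scaleR_right
        bounded_linear_compose[OF bounded_linear_scaleR_right bounded_linear_mult_i])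
  have adj: "inner (T 1 x) y = inner x (T (- 1) y)" for x y
    by (simp add: T_def inner_diff inner_add A_sym inner_mult_i)
  have surj: "surj (T 1)"
    by (rule surj_if_adjoint_bounded_below[OF bl bl adj d T_below])
  define F where "F f i = laurent_operator p b a f i - z * f i" for f i
  have F: "F (coord x) = coord (T 1 x)" for x
  proof
    fix i
    have "z * coord x i = Re z *\<^sub>R coord x i + Im z *\<^sub>R (\<i> * coord x i)" by (simp add: complex_eq_iff)
    then show "F (coord x) i = coord (T 1 x) i" by (simp add: F_def T_def A_def coord_L)
  qed
  have l2: "l2 = range coord" by (metis type_definition.Rep_range type_definition_ell2)
  have "F ` l2 = coord ` range (T 1)" unfolding l2 image_image F ..
  then have range: "F ` l2 = l2" using surj l2 by simp
  have "fredholm F"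
    unfolding fredholm_def
  proof (intro conjI)
    have "f = 0" if f: "f \<in> l2" "F f = 0" for f
    proof -
      obtain x where x: "f = coord x" using coord_of_seq[OF f(1)] by metis
      have coord_0: "coord 0 = 0" by (simp add: zero_fun_def)
      have "coord (T 1 x) = coord 0" using f(2) by (simp only: x F coord_0)
      then have "T 1 x = 0" by (simp only: coord_inject)
      then have "d * norm x \<le> 0" using T_below[of x 1] by simp
      then have "x = 0" using d by (simp add: mult_le_0_iff)
      then show ?thesis by (simp only: x coord_0)
    qed
    then show "\<exists>B. finite B \<and> {f \<in> l2. F f = 0} \<subseteq> cfun.span B"
      by (intro exI[of _ "{}"]) (auto simp: cfun.span_empty)
    show "closedin l2.mtopology (F ` l2)"
      unfolding range using closedin_topspace[of l2.mtopology] by simp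
    have "\<exists>f\<in>l2. g - F f \<in> cfun.span {}" if g: "g \<in> l2" for g
    proof -
      obtain f where "f \<in> l2" "F f = g" using g range by (metis imageE)
      then show ?thesis by (auto simp: cfun.span_empty)
    qed
    then show "\<exists>B. finite B \<and> B \<subseteq> l2 \<and> (\<forall>g\<in>l2. \<exists>f\<in>l2. g - F f \<in> cfun.span B)"
      by (intro exI[of _ "{}"]) auto
  qed
  then show ?thesis by (simp add: essential_spectrum_def F_def[abs_def])
qed

text \<open>Approximate eigenvectors may be cut off to finite support, and their translates by sufficiently
many blocks have disjoint supports, which avoid the supports of any finitely many given vectors.
These translates are again approximate eigenvectors, so they contradict closed range and finite
codimension of \<open>L - t\<close>.\<close>

lemma approximate_eigenvalue_in_essential_spectrum:
  assumes ap: "\<And>e. e > 0 \<Longrightarrow> \<exists>x. norm x = 1 \<and> norm (L x - t *\<^sub>R x) < e"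
  shows "of_real t \<in> essential_spectrum (laurent_operator p b a)"
proof (rule ccontr)
  define A where "A x = L x - t *\<^sub>R x" for x
  define F where "F f i = laurent_operator p b a f i - of_real t * f i" for f i
  have F: "F (coord x) = coord (A x)" for x
    by (simp add: F_def A_def coord_L fun_eq_iff scaleR_conv_of_real)
  have l2: "l2 = range coord" by (metis type_definition.Rep_range type_definition_ell2)
  have bl: "bounded_linear A" unfolding A_def
    by (intro bounded_linear_sub bounded_linear_L bounded_linear_scaleR_right)
  interpret A: bounded_linear A by (rule bl)
  have A_sym: "inner (A x) y = inner x (A y)" for x y by (simp add: A_def inner_diff inner_L)
  have A_shift: "A (shift (int p * k) x) = shift (int p * k) (A x)" for k x
    by (simp add: A_def L_shift shift_diff shift_scaleR)
  assume "of_real t \<notin> essential_spectrum (laurent_operator p b a)"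
  then have "fredholm F" by (simp add: essential_spectrum_def F_def[abs_def])
  then obtain B where cl: "closedin l2.mtopology (F ` l2)" and B: "finite B" "B \<subseteq> l2"
    and cod: "\<And>g. g \<in> l2 \<Longrightarrow> \<exists>f\<in>l2. g - F f \<in> cfun.span B"
    unfolding fredholm_def by blast
  have "F ` l2 = coord ` range A" unfolding l2 image_image F ..
  then have closed: "closed (range A)" using cl closed_if_closedin_l2 by simp
  define B' where "B' = of_seq ` B \<union> mult_i ` of_seq ` B"
  have cod': "\<exists>y. x - A y \<in> span B'" for x
  proof -
    obtain f where f: "f \<in> l2" "coord x - F f \<in> cfun.span B" using cod[OF coord] by blast
    obtain y where y: "f = coord y" using coord_of_seq[OF f(1)] by metis
    obtain s where s: "s \<in> span B'" "coord x - F f = coord s"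
      using cfun_span_real_span[OF f(2) B(2)] by (auto simp: B'_def)
    have "coord (x - A y) = coord s" using s(2) by (simp add: y F minus_ell2.rep_eq fun_diff_def)
    then have "x - A y = s" by (simp only: coord_inject)
    then show ?thesis using s(1) by blast
  qed
  have sing: "\<exists>g :: nat \<Rightarrow> ell2. \<forall>i<N. g i \<in> finite_support \<and> norm (g i) = 1 \<and> norm (A (g i)) \<le> e \<and>
      (\<forall>f\<in>S. inner (g i) f = 0) \<and> (\<forall>j<N. j \<noteq> i \<longrightarrow> inner (g i) (g j) = 0)"
    if S: "finite S" "S \<subseteq> finite_support" and e: "e > 0" for N S e
  proof -
    obtain K where K: "\<And>x. norm (A x) \<le> norm x * K" "K > 0" using A.pos_bounded by blast
    have "e / 4 > 0" using e by simp
    from ap[OF this] obtain x0 where x0: "norm x0 = 1" "norm (A x0) < e / 4" by (auto simp: A_def)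
    have "min (1/2) (e / (4 * K)) > 0" using e K by simp
    from finite_support_dense[OF this, of x0] obtain x1 where x1: "x1 \<in> finite_support"
      "norm (x0 - x1) < 1/2" "norm (x0 - x1) < e / (4 * K)" by auto
    have n1: "norm x1 \<ge> 1/2" using norm_triangle_ineq2[of x0 x1] x0 x1 by simp
    have "norm (A (x0 - x1)) \<le> norm (x0 - x1) * K" by (rule K)
    also have "\<dots> \<le> e / (4 * K) * K" using x1(3) K(2) by (intro mult_right_mono) auto
    also have "\<dots> = e / 4" using K(2) by simp
    finally have A1: "norm (A x1) \<le> e / 2"
      using norm_triangle_ineq2[of "A x1" "A x0"] x0(2) by (simp add: A.diff norm_minus_commute)
    define x where "x = x1 /\<^sub>R norm x1"
    have "x1 \<noteq> 0" using n1 by auto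
    then have nx: "norm x = 1" by (simp add: x_def)
    have Ax: "norm (A x) \<le> e"
    proof -
      have "norm (A x1) \<le> e * norm x1" using A1 mult_left_mono[OF n1, of e] e by linarith
      then show ?thesis using \<open>x1 \<noteq> 0\<close> by (simp add: x_def A.scaleR field_simps)
    qed
    have fx: "x \<in> finite_support"
      unfolding x_def by (rule subspace_scale[OF subspace_finite_support x1(1)])
    define Z where "Z = {i. coord x i \<noteq> 0} \<union> (\<Union>f\<in>S. {i. coord f i \<noteq> 0})"
    have Z: "finite Z" using S fx by (auto simp: Z_def finite_support_def)
    \<comment> \<open>All supports lie in \<open>[-R, R]\<close>, so translations by distinct positive multiples of \<open>d \<ge> 2 * R + 1\<close>
      separate them; the factor \<open>p\<close> in \<open>d\<close> makes these translations commute with \<open>L\<close>.\<close>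
    define R where "R = Max (abs ` insert 0 Z)"
    have R: "\<bar>i\<bar> \<le> R" if "i \<in> insert 0 Z" for i unfolding R_def using Z that by (intro Max_ge) auto
    have R0: "R \<ge> 0" using R[of 0] by simp
    define d where "d = int p * (2 * R + 1)"
    have "1 * (2 * R + 1) \<le> d" unfolding d_def using p R0 by (intro mult_right_mono) auto
    then have d: "d \<ge> 2 * R + 1" by simp
    define g where "g i = shift (int p * ((2 * R + 1) * (int i + 1))) x" for i
    have cg: "coord (g i) m = coord x (m - d * (int i + 1))" for i m
      by (simp add: g_def d_def mult.assoc)
    have near: "\<bar>m - d * (int i + 1)\<bar> \<le> R" if "coord (g i) m \<noteq> 0" for i m
      using that by (intro R) (simp add: cg Z_def)
    show ?thesis
    proof (intro exI[of _ g] allI impI conjI ballI)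
      fix i
      have "{m. coord (g i) m \<noteq> 0} = (\<lambda>m. m + d * (int i + 1)) ` {m. coord x m \<noteq> 0}"
        by (force simp: cg image_iff)
      then show "g i \<in> finite_support" using fx by (simp add: finite_support_def)
      show "norm (g i) = 1" using nx by (simp add: g_def)
      show "norm (A (g i)) \<le> e" using Ax by (simp add: g_def A_shift)
      show "inner (g i) f = 0" if f: "f \<in> S" for f
      proof (rule inner_eq_0_if_disjoint_support, rule ccontr)
        fix m assume "\<not> (coord (g i) m = 0 \<or> coord f m = 0)"
        then have "\<bar>m - d * (int i + 1)\<bar> \<le> R" "\<bar>m\<bar> \<le> R" using near R f by (auto simp: Z_def)
        moreover have "d * 1 \<le> d * (int i + 1)" using d R0 by (intro mult_left_mono) auto
        ultimately show False using d by linarith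
      qed
      show "inner (g i) (g j) = 0" if ij: "j \<noteq> i" for j
      proof (rule inner_eq_0_if_disjoint_support, rule ccontr)
        fix m assume "\<not> (coord (g i) m = 0 \<or> coord (g j) m = 0)"
        then have "\<bar>m - d * (int i + 1)\<bar> \<le> R" "\<bar>m - d * (int j + 1)\<bar> \<le> R" using near by auto
        then have "\<bar>d * (int i + 1) - d * (int j + 1)\<bar> \<le> 2 * R" by linarith
        moreover have "d * (int i + 1) - d * (int j + 1) = d * (int i - int j)" by (simp add: algebra_simps)
        moreover have "d * 1 \<le> d * \<bar>int i - int j\<bar>" using ij d R0 by (intro mult_left_mono) auto
        ultimately show False using d R0 by (simp add: abs_mult)
      qed
    qed
  qed
  have "finite B'" using B(1) by (simp add: B'_def)
  show False
    by (rule no_singular_sequence_if_closed_range_finite_codimension[OF bl A_sym closed \<open>finite B'\<close> cod'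
          subspace_finite_support sing])
qed

lemma essential_spectrum_disconnected:
  assumes mono: "\<And>i. 1 \<le> i \<Longrightarrow> i < p \<Longrightarrow> b i \<le> b (i + 1)" and k: "1 \<le> k" "k < p" "b k < b (k + 1)"
  shows "\<not> connected (essential_spectrum (laurent_operator p b a))"
proof
  let ?E = "essential_spectrum (laurent_operator p b a)"
  obtain l d x0 x1 where d: "d > 0" "\<And>x. d * norm x \<le> norm (L x - l *\<^sub>R x)"
    and x0: "inner (L x0) x0 < l * (norm x0)\<^sup>2" and x1: "inner (L x1) x1 > l * (norm x1)\<^sup>2"
    using form_gap[OF mono k] by blast
  obtain t0 where t0: "t0 < l" "\<And>e. e > 0 \<Longrightarrow> \<exists>x. norm x = 1 \<and> norm (L x - t0 *\<^sub>R x) < e"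
    using approximate_eigenvalue_below[OF bounded_linear_L inner_L x0] by blast
  obtain t1 where t1: "t1 < - l" "\<And>e. e > 0 \<Longrightarrow> \<exists>x. norm x = 1 \<and> norm (- L x - t1 *\<^sub>R x) < e"
    using approximate_eigenvalue_below[of "\<lambda>x. - L x" x1 "- l"] x1 bounded_linear_minus[OF bounded_linear_L]
    by (auto simp: inner_L)
  have "norm (L x - (- t1) *\<^sub>R x) = norm (- L x - t1 *\<^sub>R x)" for x
    by (subst norm_minus_cancel[symmetric]) (simp add: algebra_simps)
  then have ap1: "\<exists>x. norm x = 1 \<and> norm (L x - (- t1) *\<^sub>R x) < e" if "e > 0" for e
    using t1(2)[OF that] by simp
  have "of_real t0 \<in> ?E" by (rule approximate_eigenvalue_in_essential_spectrum[OF t0(2)])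
  then have "t0 \<in> Re ` ?E" by force
  moreover have "of_real (- t1) \<in> ?E" by (rule approximate_eigenvalue_in_essential_spectrum[OF ap1])
  then have "- t1 \<in> Re ` ?E" by force
  moreover assume "connected ?E"
  then have "connected (Re ` ?E)" by (intro connected_continuous_image continuous_intros)
  ultimately have "{t0..- t1} \<subseteq> Re ` ?E" by (intro connected_contains_Icc)
  then have "l \<in> Re ` ?E" using t0(1) t1(1) by force
  then obtain z where "z \<in> ?E" "Re z = l" by blast
  then show False using not_in_essential_spectrum[OF d(1), of z] d(2) by blast
qed

end

theorem theorem4p1:
  fixes p :: nat and a b :: "nat \<Rightarrow> real"
  assumes "p \<ge> 2"
    and "\<forall>i\<in>{1..p}. \<forall>j\<in>{1..p}. i \<le> j \<longrightarrow> b i \<le> b j"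
    and "summable (\<lambda>k. \<bar>a k\<bar>)"
    and "connected (essential_spectrum (laurent_operator p b a))"
  shows "\<forall>i\<in>{1..p}. \<forall>j\<in>{1..p}. b i = b j"
proof -
  interpret laurent_matrix p b a using assms by unfold_locales
  have mono: "b i \<le> b (i + 1)" if "1 \<le> i" "i < p" for i using assms(2) that by auto
  have step: "b (Suc i) = b i" if "1 \<le> i" "i < p" for i
    using essential_spectrum_disconnected[OF mono that] assms(4) mono[OF that] by force
  have first: "b (Suc i) = b 1" if "Suc i \<le> p" for i
    using that by (induction i) (simp_all add: step)
  show ?thesis
  proof (intro ballI)
    fix i j assume "i \<in> {1..p}" "j \<in> {1..p}"
    then have "Suc (i - 1) = i" "Suc (i - 1) \<le> p" "Suc (j - 1) = j" "Suc (j - 1) \<le> p" by auto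
    then show "b i = b j" using first[of "i - 1"] first[of "j - 1"] by simp
  qed
qed

end
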